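(* Let $\mathcal{A}$ be a bicomplete, locally small abelian category and let $\mathcal{C}=\{\sigma_i:S_i\hookrightarrow1_{\mathcal{A}}\}_{i\in I}$ be a collection (with $I$ a class, not necessarily a set) of radicals of $\mathcal{A}$. Then the meet $\bigwedge_{i\in I}\sigma_i$ in $Pr(\mathcal{A})$ is a radical.
   Context: Bicomplete means complete and cocomplete; locally small means that the class of subobjects of each object is a set. A preradical of an abelian category $\mathcal{A}$ is a subobject of the identity functor $1_{\mathcal{A}}$ in the (possibly extended) abelian category $\mathrm{Fun}(\mathcal{A},\mathcal{A})$, i.e. the equivalence class of a monomorphic natural transformation $\tau:T\hookrightarrow 1_{\mathcal{A}}$, two such being equivalent if each factors through the other. $Pr(\mathcal{A})$ is the collection of preradicals, ordered by $\tau\leq\sigma$ iff $\tau$ factors through $\sigma$; under the stated hypotheses on $\mathcal{A}$ every collection of preradicals has a join $\bigvee$ and a meet $\bigwedge$. For $\sigma:S\hookrightarrow 1_{\mathcal{A}}$, $\sigma^*:1_{\mathcal{A}}\twoheadrightarrow S^*$ denotes its cokernel. For $\tau:T\hookrightarrow 1_{\mathcal{A}}$ and $\sigma:S\hookrightarrow 1_{\mathcal{A}}$, the coproduct $(\sigma:\tau)$ is the preradical represented by the pullback of $\tau S^*:TS^*\hookrightarrow S^*$ along $\sigma^*:1_{\mathcal{A}}\to S^*$ (where $(\tau S^* )_A=\tau_{S^*(A)}$). The preradical $\sigma$ is a radical if $(\sigma:\sigma)=\sigma$. *)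

theory Defs
  imports "HOL-Algebra.Group" "HOL-Library.Equipollence"
begin

section \<open>Sets and classes\<close>

text \<open>
  Classes are HOL sets over arbitrary types.  The universe of sets is given by a type \<open>'u\<close>: a
  class is (isomorphic to) a set iff its cardinality is below that of \<open>'u\<close>.
\<close>

definition small :: "'u itself \<Rightarrow> 'a set \<Rightarrow> bool" where
  "small U X \<longleftrightarrow> X \<prec> (UNIV :: 'u set)"

text \<open>
  The cardinality of \<open>'u\<close> is infinite, a strong limit and regular: the small sets are those of a
  Grothendieck universe.  As in SGA 4, the universe of hereditarily finite sets is not excluded;
  every uncountable \<open>'u\<close> satisfying this predicate has strongly inaccessible cardinality.
\<close>

definition universe :: "'u itself \<Rightarrow> bool" where
  "universe U \<longleftrightarrow>
     infinite (UNIV :: 'u set) \<and>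
     (\<forall>X :: 'u set. small U X \<longrightarrow> small U (Pow X)) \<and>
     (\<forall>(X :: 'u set) (Y :: 'u \<Rightarrow> 'u set).
        small U X \<longrightarrow> (\<forall>x\<in>X. small U (Y x)) \<longrightarrow> small U (\<Union>x\<in>X. Y x))"


section \<open>Categories\<close>

record ('o, 'm) cat =
  Obj :: "'o set"
  Arr :: "'m set"
  Dom :: "'m \<Rightarrow> 'o"
  Cod :: "'m \<Rightarrow> 'o"
  Ident :: "'o \<Rightarrow> 'm"
  Comp :: "'m \<Rightarrow> 'm \<Rightarrow> 'm" (infixr \<open>\<cdot>\<index>\<close> 70)

definition Hom :: "('o, 'm) cat \<Rightarrow> 'o \<Rightarrow> 'o \<Rightarrow> 'm set" where
  "Hom C X Y = {f \<in> Arr C. Dom C f = X \<and> Cod C f = Y}"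

text \<open>
  Hom-classes are not required to be small.  For the categories considered below this is automatic:
  sending an arrow to its graph embeds \<open>Hom C X Y\<close> into the subobjects of \<open>X \<times> Y\<close>.
\<close>

locale category =
  fixes C :: "('o, 'm) cat" (structure)
  assumes Dom_in: "f \<in> Arr C \<Longrightarrow> Dom C f \<in> Obj C"
    and Cod_in: "f \<in> Arr C \<Longrightarrow> Cod C f \<in> Obj C"
    and Ident_in: "X \<in> Obj C \<Longrightarrow> Ident C X \<in> Hom C X X"
    and Comp_in: "\<lbrakk>f \<in> Hom C X Y; g \<in> Hom C Y Z\<rbrakk> \<Longrightarrow> g \<cdot> f \<in> Hom C X Z"
    and Ident_left: "f \<in> Hom C X Y \<Longrightarrow> Ident C Y \<cdot> f = f"
    and Ident_right: "f \<in> Hom C X Y \<Longrightarrow> f \<cdot> Ident C X = f"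
    and Comp_assoc:
      "\<lbrakk>f \<in> Hom C W X; g \<in> Hom C X Y; h \<in> Hom C Y Z\<rbrakk> \<Longrightarrow> (h \<cdot> g) \<cdot> f = h \<cdot> (g \<cdot> f)"

definition opp :: "('o, 'm) cat \<Rightarrow> ('o, 'm) cat" where
  "opp C = \<lparr>Obj = Obj C, Arr = Arr C, Dom = Cod C, Cod = Dom C, Ident = Ident C,
            Comp = (\<lambda>g f. f \<cdot>\<^bsub>C\<^esub> g)\<rparr>"

definition monic :: "('o, 'm) cat \<Rightarrow> 'm \<Rightarrow> bool" where
  "monic C m \<longleftrightarrow> m \<in> Arr C \<and>
     (\<forall>W\<in>Obj C. \<forall>f\<in>Hom C W (Dom C m). \<forall>g\<in>Hom C W (Dom C m).
        m \<cdot>\<^bsub>C\<^esub> f = m \<cdot>\<^bsub>C\<^esub> g \<longrightarrow> f = g)"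

definition epic :: "('o, 'm) cat \<Rightarrow> 'm \<Rightarrow> bool" where
  "epic C e \<longleftrightarrow> monic (opp C) e"

definition zero_object :: "('o, 'm) cat \<Rightarrow> 'o \<Rightarrow> bool" where
  "zero_object C Z \<longleftrightarrow> Z \<in> Obj C \<and>
     (\<forall>X\<in>Obj C. (\<exists>!f. f \<in> Hom C X Z) \<and> (\<exists>!f. f \<in> Hom C Z X))"

definition zero_arrow :: "('o, 'm) cat \<Rightarrow> 'm \<Rightarrow> bool" where
  "zero_arrow C f \<longleftrightarrow> f \<in> Arr C \<and>
     (\<exists>Z. zero_object C Z \<and>
        (\<exists>g\<in>Hom C (Dom C f) Z. \<exists>h\<in>Hom C Z (Cod C f). f = h \<cdot>\<^bsub>C\<^esub> g))"

definition is_kernel :: "('o, 'm) cat \<Rightarrow> 'm \<Rightarrow> 'm \<Rightarrow> bool" where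
  "is_kernel C f k \<longleftrightarrow>
     f \<in> Arr C \<and> k \<in> Arr C \<and> Cod C k = Dom C f \<and> zero_arrow C (f \<cdot>\<^bsub>C\<^esub> k) \<and>
     (\<forall>g\<in>Arr C. Cod C g = Dom C f \<and> zero_arrow C (f \<cdot>\<^bsub>C\<^esub> g) \<longrightarrow>
        (\<exists>!h. h \<in> Hom C (Dom C g) (Dom C k) \<and> k \<cdot>\<^bsub>C\<^esub> h = g))"

definition is_cokernel :: "('o, 'm) cat \<Rightarrow> 'm \<Rightarrow> 'm \<Rightarrow> bool" where
  "is_cokernel C f q \<longleftrightarrow> is_kernel (opp C) f q"

text \<open>\<open>f'\<close> is the pullback of \<open>f\<close> along \<open>g\<close>; the square is \<open>g f' = f g'\<close>.\<close>

definition is_pullback :: "('o, 'm) cat \<Rightarrow> 'm \<Rightarrow> 'm \<Rightarrow> 'm \<Rightarrow> 'm \<Rightarrow> bool" where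
  "is_pullback C f g f' g' \<longleftrightarrow>
     f \<in> Arr C \<and> g \<in> Arr C \<and> Cod C f = Cod C g \<and>
     f' \<in> Arr C \<and> g' \<in> Arr C \<and> Dom C f' = Dom C g' \<and> Cod C f' = Dom C g \<and> Cod C g' = Dom C f \<and>
     g \<cdot>\<^bsub>C\<^esub> f' = f \<cdot>\<^bsub>C\<^esub> g' \<and>
     (\<forall>W\<in>Obj C. \<forall>u\<in>Hom C W (Dom C g). \<forall>v\<in>Hom C W (Dom C f).
        g \<cdot>\<^bsub>C\<^esub> u = f \<cdot>\<^bsub>C\<^esub> v \<longrightarrow>
        (\<exists>!h. h \<in> Hom C W (Dom C f') \<and> f' \<cdot>\<^bsub>C\<^esub> h = u \<and> g' \<cdot>\<^bsub>C\<^esub> h = v))"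


section \<open>Abelian categories\<close>

text \<open>An addition of parallel arrows making all hom-classes abelian groups and composition biadditive.\<close>

definition preadditive :: "('o, 'm) cat \<Rightarrow> ('m \<Rightarrow> 'm \<Rightarrow> 'm) \<Rightarrow> bool" where
  "preadditive C add \<longleftrightarrow>
     (\<forall>X\<in>Obj C. \<forall>Y\<in>Obj C. \<exists>z. comm_group \<lparr>carrier = Hom C X Y, monoid.mult = add, one = z\<rparr>) \<and>
     (\<forall>X\<in>Obj C. \<forall>Y\<in>Obj C. \<forall>Z\<in>Obj C. \<forall>f\<in>Hom C X Y. \<forall>f'\<in>Hom C X Y. \<forall>g\<in>Hom C Y Z. \<forall>g'\<in>Hom C Y Z.
        g \<cdot>\<^bsub>C\<^esub> add f f' = add (g \<cdot>\<^bsub>C\<^esub> f) (g \<cdot>\<^bsub>C\<^esub> f') \<and>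
        add g g' \<cdot>\<^bsub>C\<^esub> f = add (g \<cdot>\<^bsub>C\<^esub> f) (g' \<cdot>\<^bsub>C\<^esub> f))"

definition has_biproducts :: "('o, 'm) cat \<Rightarrow> ('m \<Rightarrow> 'm \<Rightarrow> 'm) \<Rightarrow> bool" where
  "has_biproducts C add \<longleftrightarrow>
     (\<forall>X\<in>Obj C. \<forall>Y\<in>Obj C. \<exists>B\<in>Obj C.
        \<exists>i\<in>Hom C X B. \<exists>j\<in>Hom C Y B. \<exists>p\<in>Hom C B X. \<exists>q\<in>Hom C B Y.
          p \<cdot>\<^bsub>C\<^esub> i = Ident C X \<and> q \<cdot>\<^bsub>C\<^esub> j = Ident C Y \<and>
          add (i \<cdot>\<^bsub>C\<^esub> p) (j \<cdot>\<^bsub>C\<^esub> q) = Ident C B)"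

definition abelian_category :: "('o, 'm) cat \<Rightarrow> bool" where
  "abelian_category C \<longleftrightarrow>
     category C \<and>
     (\<exists>add. preadditive C add \<and> has_biproducts C add) \<and>
     (\<exists>Z. zero_object C Z) \<and>
     (\<forall>f\<in>Arr C. \<exists>k. is_kernel C f k) \<and>
     (\<forall>f\<in>Arr C. \<exists>q. is_cokernel C f q) \<and>
     (\<forall>m. monic C m \<longrightarrow> (\<exists>f. is_kernel C f m)) \<and>
     (\<forall>e. epic C e \<longrightarrow> (\<exists>f. is_cokernel C f e))"


section \<open>Functors and natural transformations\<close>

record ('o, 'm, 'p, 'n) ftor =
  FObj :: "'o \<Rightarrow> 'p"
  FArr :: "'m \<Rightarrow> 'n"

text \<open>
  The underlying maps are extensional (\<open>undefined\<close> outside the source), so that HOL equality is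
  equality of functors, and likewise for natural transformations.
\<close>

definition is_functor :: "('o, 'm) cat \<Rightarrow> ('p, 'n) cat \<Rightarrow> ('o, 'm, 'p, 'n) ftor \<Rightarrow> bool" where
  "is_functor C D F \<longleftrightarrow>
     FObj F \<in> Obj C \<rightarrow>\<^sub>E Obj D \<and>
     FArr F \<in> Arr C \<rightarrow>\<^sub>E Arr D \<and>
     (\<forall>X Y. \<forall>f\<in>Hom C X Y. FArr F f \<in> Hom D (FObj F X) (FObj F Y)) \<and>
     (\<forall>X\<in>Obj C. FArr F (Ident C X) = Ident D (FObj F X)) \<and>
     (\<forall>X Y Z. \<forall>f\<in>Hom C X Y. \<forall>g\<in>Hom C Y Z. FArr F (g \<cdot>\<^bsub>C\<^esub> f) = FArr F g \<cdot>\<^bsub>D\<^esub> FArr F f)"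

definition id_functor :: "('o, 'm) cat \<Rightarrow> ('o, 'm, 'o, 'm) ftor" where
  "id_functor C = \<lparr>FObj = restrict (\<lambda>X. X) (Obj C), FArr = restrict (\<lambda>f. f) (Arr C)\<rparr>"

definition comp_functor ::
  "('o, 'm) cat \<Rightarrow> ('p, 'n, 'q, 'k) ftor \<Rightarrow> ('o, 'm, 'p, 'n) ftor \<Rightarrow> ('o, 'm, 'q, 'k) ftor" where
  "comp_functor C G F =
     \<lparr>FObj = (\<lambda>X\<in>Obj C. FObj G (FObj F X)), FArr = (\<lambda>f\<in>Arr C. FArr G (FArr F f))\<rparr>"

record ('o, 'm, 'p, 'n) ntrans =
  NDom :: "('o, 'm, 'p, 'n) ftor"
  NCod :: "('o, 'm, 'p, 'n) ftor"
  NMap :: "'o \<Rightarrow> 'n"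

definition is_ntrans :: "('o, 'm) cat \<Rightarrow> ('p, 'n) cat \<Rightarrow> ('o, 'm, 'p, 'n) ntrans \<Rightarrow> bool" where
  "is_ntrans C D \<eta> \<longleftrightarrow>
     is_functor C D (NDom \<eta>) \<and> is_functor C D (NCod \<eta>) \<and>
     NMap \<eta> \<in> extensional (Obj C) \<and>
     (\<forall>X\<in>Obj C. NMap \<eta> X \<in> Hom D (FObj (NDom \<eta>) X) (FObj (NCod \<eta>) X)) \<and>
     (\<forall>X Y. \<forall>f\<in>Hom C X Y.
        NMap \<eta> Y \<cdot>\<^bsub>D\<^esub> FArr (NDom \<eta>) f = FArr (NCod \<eta>) f \<cdot>\<^bsub>D\<^esub> NMap \<eta> X)"

definition functor_category ::
  "('o, 'm) cat \<Rightarrow> ('p, 'n) cat \<Rightarrow> (('o, 'm, 'p, 'n) ftor, ('o, 'm, 'p, 'n) ntrans) cat" where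
  "functor_category C D =
     \<lparr>Obj = {F. is_functor C D F}, Arr = {\<eta>. is_ntrans C D \<eta>}, Dom = NDom, Cod = NCod,
      Ident = (\<lambda>F. \<lparr>NDom = F, NCod = F, NMap = (\<lambda>X\<in>Obj C. Ident D (FObj F X))\<rparr>),
      Comp = (\<lambda>\<theta> \<eta>. \<lparr>NDom = NDom \<eta>, NCod = NCod \<theta>,
                      NMap = (\<lambda>X\<in>Obj C. NMap \<theta> X \<cdot>\<^bsub>D\<^esub> NMap \<eta> X)\<rparr>)\<rparr>"

text \<open>The transformation \<open>\<eta>F : NDom \<eta> \<circ> F \<rightarrow> NCod \<eta> \<circ> F\<close>, whose component at \<open>X\<close> is that of \<open>\<eta>\<close> at \<open>F X\<close>.\<close>

definition whisker ::
  "('o, 'm) cat \<Rightarrow> ('p, 'n, 'q, 'k) ntrans \<Rightarrow> ('o, 'm, 'p, 'n) ftor \<Rightarrow> ('o, 'm, 'q, 'k) ntrans" where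
  "whisker C \<eta> F =
     \<lparr>NDom = comp_functor C (NDom \<eta>) F, NCod = comp_functor C (NCod \<eta>) F,
      NMap = (\<lambda>X\<in>Obj C. NMap \<eta> (FObj F X))\<rparr>"


section \<open>Limits and colimits\<close>

definition is_cone ::
  "('j, 'a) cat \<Rightarrow> ('o, 'm) cat \<Rightarrow> ('j, 'a, 'o, 'm) ftor \<Rightarrow> 'o \<Rightarrow> ('j \<Rightarrow> 'm) \<Rightarrow> bool" where
  "is_cone J C D X \<pi> \<longleftrightarrow>
     X \<in> Obj C \<and>
     (\<forall>j\<in>Obj J. \<pi> j \<in> Hom C X (FObj D j)) \<and>
     (\<forall>i j. \<forall>u\<in>Hom J i j. FArr D u \<cdot>\<^bsub>C\<^esub> \<pi> i = \<pi> j)"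

definition is_limit ::
  "('j, 'a) cat \<Rightarrow> ('o, 'm) cat \<Rightarrow> ('j, 'a, 'o, 'm) ftor \<Rightarrow> 'o \<Rightarrow> ('j \<Rightarrow> 'm) \<Rightarrow> bool" where
  "is_limit J C D X \<pi> \<longleftrightarrow>
     is_cone J C D X \<pi> \<and>
     (\<forall>Y \<psi>. is_cone J C D Y \<psi> \<longrightarrow>
        (\<exists>!h. h \<in> Hom C Y X \<and> (\<forall>j\<in>Obj J. \<pi> j \<cdot>\<^bsub>C\<^esub> h = \<psi> j)))"

text \<open>
  Every small category is isomorphic to one whose objects and arrows form small sets over the
  type \<open>'u\<close>, so it suffices to let the index category range over those.
\<close>

definition complete_category :: "'u itself \<Rightarrow> ('o, 'm) cat \<Rightarrow> bool" where
  "complete_category U C \<longleftrightarrow>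
     (\<forall>(J :: ('u, 'u) cat) D.
        category J \<and> small U (Obj J) \<and> small U (Arr J) \<and> is_functor J C D \<longrightarrow>
        (\<exists>X \<pi>. is_limit J C D X \<pi>))"

definition cocomplete_category :: "'u itself \<Rightarrow> ('o, 'm) cat \<Rightarrow> bool" where
  "cocomplete_category U C \<longleftrightarrow> complete_category U (opp C)"

definition bicomplete :: "'u itself \<Rightarrow> ('o, 'm) cat \<Rightarrow> bool" where
  "bicomplete U C \<longleftrightarrow> complete_category U C \<and> cocomplete_category U C"


section \<open>Subobjects\<close>

definition factors_through :: "('o, 'm) cat \<Rightarrow> 'm \<Rightarrow> 'm \<Rightarrow> bool" where
  "factors_through C f g \<longleftrightarrow> (\<exists>h\<in>Hom C (Dom C f) (Dom C g). f = g \<cdot>\<^bsub>C\<^esub> h)"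

definition monos_into :: "('o, 'm) cat \<Rightarrow> 'o \<Rightarrow> 'm set" where
  "monos_into C X = {m. monic C m \<and> Cod C m = X}"

definition mono_equiv :: "('o, 'm) cat \<Rightarrow> 'o \<Rightarrow> ('m \<times> 'm) set" where
  "mono_equiv C X =
     {(m, n). m \<in> monos_into C X \<and> n \<in> monos_into C X \<and>
        factors_through C m n \<and> factors_through C n m}"

definition Sub :: "('o, 'm) cat \<Rightarrow> 'o \<Rightarrow> 'm set gorder" where
  "Sub C X =
     \<lparr>carrier = monos_into C X // mono_equiv C X, eq = (=),
      le = (\<lambda>P Q. \<exists>m\<in>P. \<exists>n\<in>Q. factors_through C m n)\<rparr>"

text \<open>Local smallness in the sense of well-poweredness.\<close>

definition locally_small :: "'u itself \<Rightarrow> ('o, 'm) cat \<Rightarrow> bool" where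
  "locally_small U C \<longleftrightarrow> (\<forall>X\<in>Obj C. small U (carrier (Sub C X)))"


section \<open>Preradicals\<close>

type_synonym ('o, 'm) preradical = "('o, 'm, 'o, 'm) ntrans set"

definition Pr :: "('o, 'm) cat \<Rightarrow> ('o, 'm) preradical gorder" where
  "Pr A = Sub (functor_category A A) (id_functor A)"

text \<open>
  In \<open>(\<sigma> : \<tau>)\<close>, \<open>q : 1 \<rightarrow> S\<^sup>*\<close> is a cokernel of a representative \<open>s\<close> of \<open>\<sigma>\<close>, and \<open>p\<close> is the pullback
  along \<open>q\<close> of \<open>t S\<^sup>*\<close> for a representative \<open>t\<close> of \<open>\<tau>\<close>.
\<close>

definition coproduct ::
  "('o, 'm) cat \<Rightarrow> ('o, 'm) preradical \<Rightarrow> ('o, 'm) preradical \<Rightarrow> ('o, 'm) preradical" where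
  "coproduct A \<sigma> \<tau> =
     (THE \<rho>. \<exists>s\<in>\<sigma>. \<exists>t\<in>\<tau>. \<exists>q p p'.
        is_cokernel (functor_category A A) s q \<and>
        is_pullback (functor_category A A) (whisker A t (NCod q)) q p p' \<and>
        \<rho> = mono_equiv (functor_category A A) (id_functor A) `` {p})"

definition radical :: "('o, 'm) cat \<Rightarrow> ('o, 'm) preradical \<Rightarrow> bool" where
  "radical A \<sigma> \<longleftrightarrow> \<sigma> \<in> carrier (Pr A) \<and> coproduct A \<sigma> \<sigma> = \<sigma>"

end

theory Submission
  imports Defs
begin

text \<open>
  Let \<open>q : 1 \<rightarrow> S\<^sup>*\<close> be a cokernel of \<open>s : S \<rightarrow> 1\<close>.  By the universal property of the pullback,
  \<open>\<sigma> = [s]\<close> is a radical iff every \<open>u : U \<rightarrow> 1\<close> for which \<open>q u\<close> factors through \<open>s S\<^sup>*\<close>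
  factors through \<open>s\<close>.  Let \<open>t : T \<rightarrow> 1\<close> be the intersection of radicals, with cokernel \<open>r\<close>, and
  let \<open>r u\<close> factor through \<open>t T\<^sup>*\<close>.  If \<open>t\<close> factors through \<open>s\<close>, then \<open>q = w r\<close> for some
  \<open>w : T\<^sup>* \<rightarrow> S\<^sup>*\<close>, and \<open>w \<cdot> t T\<^sup>* = t S\<^sup>* \<cdot> T w\<close> by naturality, so that \<open>q u = w r u\<close> factors through
  \<open>s S\<^sup>*\<close> and hence \<open>u\<close> factors through \<open>s\<close>.  Thus \<open>u\<close> factors through the intersection \<open>t\<close>.

  The intersection exists although the index class may be large: at each object only a small set
  of subobjects occurs, and their intersection is the kernel of the map into the product of the
  corresponding quotients.
\<close>

section \<open>Subobjects and pullbacks in a category\<close>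

lemma Hom_iff: "f \<in> Hom C X Y \<longleftrightarrow> f \<in> Arr C \<and> Dom C f = X \<and> Cod C f = Y"
  by (auto simp: Hom_def)

context category
begin

section \<open>Composition, monos and factorization of arrows\<close>

declare Dom_in [simp] Cod_in [simp]

text \<open>The axioms phrased with \<open>Hom\<close> become rewrite rules whose side conditions
  are equations between \<open>Dom\<close> and \<open>Cod\<close>, so composability is settled by
  simplification without naming the objects involved.\<close>

lemma comp_arr [simp]: "\<lbrakk>f \<in> Arr C; g \<in> Arr C; Cod C f = Dom C g\<rbrakk> \<Longrightarrow> g \<cdot> f \<in> Arr C"
  and dom_comp [simp]: "\<lbrakk>f \<in> Arr C; g \<in> Arr C; Cod C f = Dom C g\<rbrakk> \<Longrightarrow> Dom C (g \<cdot> f) = Dom C f"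
  and cod_comp [simp]: "\<lbrakk>f \<in> Arr C; g \<in> Arr C; Cod C f = Dom C g\<rbrakk> \<Longrightarrow> Cod C (g \<cdot> f) = Cod C g"
  using Comp_in[of f "Dom C f" "Cod C f" g "Cod C g"] by (auto simp: Hom_def)

lemma comp_assoc:
  "\<lbrakk>f \<in> Arr C; g \<in> Arr C; h \<in> Arr C; Cod C f = Dom C g; Cod C g = Dom C h\<rbrakk>
    \<Longrightarrow> (h \<cdot> g) \<cdot> f = h \<cdot> (g \<cdot> f)"
  using Comp_assoc[of f "Dom C f" "Cod C f" g "Cod C g" h "Cod C h"] by (auto simp: Hom_def)

lemma ident_arr [simp]: "X \<in> Obj C \<Longrightarrow> Ident C X \<in> Arr C"
  and dom_ident [simp]: "X \<in> Obj C \<Longrightarrow> Dom C (Ident C X) = X"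
  and cod_ident [simp]: "X \<in> Obj C \<Longrightarrow> Cod C (Ident C X) = X"
  using Ident_in[of X] by (auto simp: Hom_def)

lemma ident_comp [simp]: "\<lbrakk>f \<in> Arr C; Cod C f = X\<rbrakk> \<Longrightarrow> Ident C X \<cdot> f = f"
  and comp_ident [simp]: "\<lbrakk>f \<in> Arr C; Dom C f = X\<rbrakk> \<Longrightarrow> f \<cdot> Ident C X = f"
  using Ident_left[of f "Dom C f" X] Ident_right[of f X "Cod C f"] by (auto simp: Hom_def)

lemma monicI:
  assumes "m \<in> Arr C"
    and "\<And>f g. \<lbrakk>f \<in> Arr C; g \<in> Arr C; Dom C f = Dom C g; Cod C f = Dom C m; Cod C g = Dom C m;
      m \<cdot> f = m \<cdot> g\<rbrakk> \<Longrightarrow> f = g"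
  shows "monic C m"
  using assms by (auto simp: monic_def Hom_def)

lemma monic_arr: "monic C m \<Longrightarrow> m \<in> Arr C"
  by (simp add: monic_def)

lemma monic_cancel:
  assumes "monic C m" "m \<cdot> f = m \<cdot> g" "f \<in> Arr C" "g \<in> Arr C" "Dom C f = Dom C g"
    "Cod C f = Dom C m" "Cod C g = Dom C m"
  shows "f = g"
proof -
  have "Dom C f \<in> Obj C" "f \<in> Hom C (Dom C f) (Dom C m)" "g \<in> Hom C (Dom C f) (Dom C m)"
    using assms by (auto simp: Hom_def)
  then show ?thesis using assms(1,2) unfolding monic_def by blast
qed

lemma factors_throughI:
  "\<lbrakk>h \<in> Arr C; Dom C h = Dom C f; Cod C h = Dom C g; f = g \<cdot> h\<rbrakk> \<Longrightarrow> factors_through C f g"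
  by (auto simp: factors_through_def Hom_def)

lemma factors_throughE:
  assumes "factors_through C f g"
  obtains h where "h \<in> Arr C" "Dom C h = Dom C f" "Cod C h = Dom C g" "g \<cdot> h = f"
  using assms by (auto simp: factors_through_def Hom_def)

lemma factors_through_compE:
  assumes "factors_through C (g \<cdot> u) f" "u \<in> Arr C" "g \<in> Arr C" "Cod C u = Dom C g"
  obtains v where "v \<in> Arr C" "Dom C v = Dom C u" "Cod C v = Dom C f" "f \<cdot> v = g \<cdot> u"
  using assms by (auto simp: factors_through_def Hom_def)

lemma factors_through_refl: "f \<in> Arr C \<Longrightarrow> factors_through C f f"
  by (rule factors_throughI[of "Ident C (Dom C f)"]) auto

lemma factors_through_trans:
  assumes "factors_through C f g" "factors_through C g h" "h \<in> Arr C"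
  shows "factors_through C f h"
proof -
  obtain a where a: "a \<in> Arr C" "Dom C a = Dom C f" "Cod C a = Dom C g" "g \<cdot> a = f"
    using assms(1) by (rule factors_throughE)
  obtain b where b: "b \<in> Arr C" "Dom C b = Dom C g" "Cod C b = Dom C h" "h \<cdot> b = g"
    using assms(2) by (rule factors_throughE)
  show ?thesis
  proof (rule factors_throughI)
    show "f = h \<cdot> (b \<cdot> a)" using a b assms(3) by (simp flip: comp_assoc)
  qed (use a b in auto)
qed

lemma factors_through_comp:
  assumes "factors_through C f g" "g \<in> Arr C" "a \<in> Arr C" "Cod C a = Dom C f"
  shows "factors_through C (f \<cdot> a) g"
proof -
  obtain b where b: "b \<in> Arr C" "Dom C b = Dom C f" "Cod C b = Dom C g" "g \<cdot> b = f"
    using assms(1) by (rule factors_throughE)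
  show ?thesis
  proof (rule factors_throughI)
    show "f \<cdot> a = g \<cdot> (b \<cdot> a)" using b assms by (simp flip: comp_assoc)
  qed (use b assms in auto)
qed

text \<open>Since \<open>f\<close> is monic, the second leg is determined by \<open>p\<close>, so a
  pullback is just a preimage subobject: it is known from the arrows that factor through it. In this
  form pullbacks can be compared as subobjects and tested pointwise in a functor category.\<close>

lemma monic_pullback_iff:
  assumes "monic C f" "g \<in> Arr C" "Cod C f = Cod C g"
  shows "(\<exists>p'. is_pullback C f g p p') \<longleftrightarrow>
    monic C p \<and> Cod C p = Dom C g \<and>
    (\<forall>u\<in>Arr C. Cod C u = Dom C g \<longrightarrow>
      (factors_through C u p \<longleftrightarrow> factors_through C (g \<cdot> u) f))"
    (is "?L \<longleftrightarrow> ?R")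
proof
  note [simp] = monic_arr[OF assms(1)] assms(2,3)
  assume ?L
  then obtain p' where pb: "is_pullback C f g p p'" ..
  then have p [simp]: "p \<in> Arr C" "p' \<in> Arr C" "Dom C p' = Dom C p" "Cod C p = Dom C g"
    "Cod C p' = Dom C f" and sq: "g \<cdot> p = f \<cdot> p'"
    by (auto simp: is_pullback_def)
  have univ: "\<exists>!h. h \<in> Hom C (Dom C u) (Dom C p) \<and> p \<cdot> h = u \<and> p' \<cdot> h = v"
    if "u \<in> Arr C" "v \<in> Arr C" "Dom C v = Dom C u" "Cod C u = Dom C g" "Cod C v = Dom C f"
      "g \<cdot> u = f \<cdot> v" for u v
  proof -
    have "Dom C u \<in> Obj C" "u \<in> Hom C (Dom C u) (Dom C g)" "v \<in> Hom C (Dom C u) (Dom C f)"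
      using that by (auto simp: Hom_def)
    then show ?thesis using pb that(6) unfolding is_pullback_def by blast
  qed
  have "monic C p"
  proof (rule monicI)
    fix a b
    assume ab [simp]: "a \<in> Arr C" "b \<in> Arr C" "Dom C a = Dom C b" "Cod C a = Dom C p"
      "Cod C b = Dom C p" and eq: "p \<cdot> a = p \<cdot> b"
    have "f \<cdot> (p' \<cdot> a) = f \<cdot> (p' \<cdot> b)"
    proof -
      have "f \<cdot> (p' \<cdot> a) = g \<cdot> (p \<cdot> a)" by (simp add: sq flip: comp_assoc)
      also have "\<dots> = f \<cdot> (p' \<cdot> b)" by (simp only: eq) (simp add: sq flip: comp_assoc)
      finally show ?thesis .
    qed
    then have eq': "p' \<cdot> a = p' \<cdot> b" by (rule monic_cancel[OF assms(1)]) auto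
    have "g \<cdot> (p \<cdot> b) = f \<cdot> (p' \<cdot> b)" by (simp add: sq flip: comp_assoc)
    \<comment> \<open>Both \<open>a\<close> and \<open>b\<close> mediate for the same pair of
      arrows, because \<open>f\<close> monic makes their second legs agree as well; uniqueness then
      identifies them.\<close>
    then have "\<exists>!h. h \<in> Hom C (Dom C (p \<cdot> b)) (Dom C p) \<and> p \<cdot> h = p \<cdot> b \<and> p' \<cdot> h = p' \<cdot> b"
      by (intro univ) auto
    moreover have "a \<in> Hom C (Dom C (p \<cdot> b)) (Dom C p)" "b \<in> Hom C (Dom C (p \<cdot> b)) (Dom C p)"
      by (auto simp: Hom_def)
    ultimately show "a = b" using eq eq' by blast
  qed simp
  moreover have "factors_through C u p \<longleftrightarrow> factors_through C (g \<cdot> u) f"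
    if u [simp]: "u \<in> Arr C" "Cod C u = Dom C g" for u
  proof
    assume "factors_through C u p"
    then obtain h where h [simp]: "h \<in> Arr C" "Dom C h = Dom C u" "Cod C h = Dom C p"
      and hu: "p \<cdot> h = u"
      by (rule factors_throughE)
    have "g \<cdot> u = f \<cdot> (p' \<cdot> h)" unfolding hu[symmetric] by (simp add: sq flip: comp_assoc)
    then show "factors_through C (g \<cdot> u) f" by (rule factors_throughI[rotated 3]) auto
  next
    assume "factors_through C (g \<cdot> u) f"
    then obtain v where "v \<in> Arr C" "Dom C v = Dom C u" "Cod C v = Dom C f" "f \<cdot> v = g \<cdot> u"
      by (rule factors_through_compE) auto
    from univ[OF u(1) this(1,2) u(2) this(3) this(4)[symmetric]] obtain h
      where "h \<in> Hom C (Dom C u) (Dom C p)" "p \<cdot> h = u"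
      by blast
    then show "factors_through C u p" by (auto simp: factors_through_def)
  qed
  ultimately show ?R by simp
next
  note [simp] = monic_arr[OF assms(1)] assms(2,3)
  assume R: ?R
  then have p [simp]: "p \<in> Arr C" "Cod C p = Dom C g" and m: "monic C p"
    by (auto simp: monic_arr)
  \<comment> \<open>The criterion at \<open>u = p\<close> produces the missing leg, since
    \<open>p\<close> factors through itself.\<close>
  have "factors_through C (g \<cdot> p) f" using R factors_through_refl[of p] by simp
  then obtain p' where p' [simp]: "p' \<in> Arr C" "Dom C p' = Dom C p" "Cod C p' = Dom C f"
    and sq': "f \<cdot> p' = g \<cdot> p"
    by (rule factors_through_compE) auto
  note sq = sq'[symmetric]
  have "\<exists>!h. h \<in> Hom C W (Dom C p) \<and> p \<cdot> h = u \<and> p' \<cdot> h = v"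
    if "u \<in> Hom C W (Dom C g)" "v \<in> Hom C W (Dom C f)" and eq: "g \<cdot> u = f \<cdot> v" for W u v
  proof -
    have uv [simp]: "u \<in> Arr C" "v \<in> Arr C" "Dom C u = W" "Dom C v = W" "Cod C u = Dom C g"
      "Cod C v = Dom C f"
      using that by (auto simp: Hom_def)
    have "factors_through C (g \<cdot> u) f"
      by (rule factors_throughI[of v]) (use eq in auto)
    then have "factors_through C u p" using R by simp
    then obtain h where h: "h \<in> Arr C" "Dom C h = Dom C u" "Cod C h = Dom C p"
      and hu: "p \<cdot> h = u"
      by (rule factors_throughE)
    have [simp]: "h \<in> Arr C" "Dom C h = W" "Cod C h = Dom C p" using h by simp_all
    \<comment> \<open>The second triangle need only commute after the mono \<open>f\<close>.\<close>
    have "f \<cdot> (p' \<cdot> h) = f \<cdot> v"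
      unfolding eq[symmetric] hu[symmetric] by (simp add: sq flip: comp_assoc)
    then have hv: "p' \<cdot> h = v" by (rule monic_cancel[OF assms(1)]) auto
    show ?thesis
    proof (rule ex1I[of _ h])
      show "h \<in> Hom C W (Dom C p) \<and> p \<cdot> h = u \<and> p' \<cdot> h = v" by (auto simp: Hom_def hu hv)
    next
      fix k
      assume k: "k \<in> Hom C W (Dom C p) \<and> p \<cdot> k = u \<and> p' \<cdot> k = v"
      then have "p \<cdot> k = p \<cdot> h" using hu by simp
      moreover have "k \<in> Arr C" "Dom C k = W" "Cod C k = Dom C p" using k by (simp_all add: Hom_iff)
      ultimately show "k = h" by - (rule monic_cancel[OF m], simp_all)
    qed
  qed
  then have "is_pullback C f g p p'"
    by (auto simp: is_pullback_def sq)
  then show ?L ..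
qed

section \<open>Subobjects of an object, their order and their meets\<close>

lemma monos_into_iff: "m \<in> monos_into C X \<longleftrightarrow> monic C m \<and> Cod C m = X"
  by (simp add: monos_into_def)

lemma equiv_mono_equiv: "equiv (monos_into C X) (mono_equiv C X)"
proof (rule equivI)
  show "mono_equiv C X \<subseteq> monos_into C X \<times> monos_into C X" by (auto simp: mono_equiv_def)
  show "refl_on (monos_into C X) (mono_equiv C X)"
    by (auto simp: refl_on_def mono_equiv_def monos_into_iff monic_arr intro: factors_through_refl)
  show "sym (mono_equiv C X)" by (auto simp: sym_def mono_equiv_def)
  show "trans (mono_equiv C X)"
  proof (rule transI)
    fix l m n
    assume "(l, m) \<in> mono_equiv C X" "(m, n) \<in> mono_equiv C X"
    then show "(l, n) \<in> mono_equiv C X"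
      using factors_through_trans[of l m n] factors_through_trans[of n m l]
      by (simp add: mono_equiv_def monos_into_iff monic_arr)
  qed
qed

lemma carrier_Sub: "carrier (Sub C X) = monos_into C X // mono_equiv C X"
  by (simp add: Sub_def)

lemma Sub_class_in:
  assumes "m \<in> monos_into C X"
  shows "mono_equiv C X `` {m} \<in> carrier (Sub C X)" "m \<in> mono_equiv C X `` {m}"
proof -
  show "mono_equiv C X `` {m} \<in> carrier (Sub C X)"
    unfolding carrier_Sub using assms by (rule quotientI)
  show "m \<in> mono_equiv C X `` {m}"
    using equiv_mono_equiv assms by (rule equiv_class_self)
qed

lemma Sub_carrierE:
  assumes "P \<in> carrier (Sub C X)"
  obtains m where "m \<in> P" "m \<in> monos_into C X"
proof -
  have "P \<in> monos_into C X // mono_equiv C X" using assms by (simp add: carrier_Sub)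
  then obtain m where "m \<in> monos_into C X" "P = mono_equiv C X `` {m}" by (rule quotientE)
  then show thesis using that Sub_class_in(2) by blast
qed

lemma Sub_carrierD:
  assumes "P \<in> carrier (Sub C X)" "m \<in> P"
  shows "m \<in> monos_into C X" "P = mono_equiv C X `` {m}"
proof -
  have "P \<in> monos_into C X // mono_equiv C X" using assms by (simp add: carrier_Sub)
  then obtain n where n: "P = mono_equiv C X `` {n}" by (rule quotientE)
  then have mn: "(n, m) \<in> mono_equiv C X" using assms(2) by simp
  then show "m \<in> monos_into C X" by (simp add: mono_equiv_def)
  show "P = mono_equiv C X `` {m}" unfolding n by (rule equiv_class_eq[OF equiv_mono_equiv mn])
qed

lemma Sub_class_eq_iff:
  assumes "m \<in> monos_into C X" "n \<in> monos_into C X"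
  shows "mono_equiv C X `` {m} = mono_equiv C X `` {n} \<longleftrightarrow>
    factors_through C m n \<and> factors_through C n m"
  using assms eq_equiv_class_iff[OF equiv_mono_equiv assms] by (auto simp: mono_equiv_def)

text \<open>The order asks for some pair of representatives, but any pair will do: equivalent monos
  factor through each other and factorization is transitive.\<close>

lemma Sub_le_iff:
  assumes "P \<in> carrier (Sub C X)" "Q \<in> carrier (Sub C X)" "m \<in> P" "n \<in> Q"
  shows "le (Sub C X) P Q \<longleftrightarrow> factors_through C m n"
proof
  assume "le (Sub C X) P Q"
  then obtain m' n' where mn: "m' \<in> P" "n' \<in> Q" "factors_through C m' n'" by (auto simp: Sub_def)
  have "(m, m') \<in> mono_equiv C X" "(n', n) \<in> mono_equiv C X"
    using mn assms Sub_carrierD(2) by blast+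
  then show "factors_through C m n"
    using mn(3) factors_through_trans[of m m' n'] factors_through_trans[of m n' n]
    by (simp add: mono_equiv_def monos_into_iff monic_arr)
qed (use assms in \<open>auto simp: Sub_def\<close>)

end

text \<open>The test arrows \<open>f\<close> are arbitrary, not only monic. This survives the
  passage to components of transformations, and it lets the pullback criterion be applied to any
  \<open>u\<close>. \<open>M\<close> may contain many representatives of one subobject.\<close>

definition intersection :: "('o, 'm) cat \<Rightarrow> 'o \<Rightarrow> 'm set \<Rightarrow> 'm \<Rightarrow> bool" where
  "intersection C X M k \<longleftrightarrow> k \<in> monos_into C X \<and>
     (\<forall>f\<in>Arr C. Cod C f = X \<longrightarrow>
       (factors_through C f k \<longleftrightarrow> (\<forall>m\<in>M. factors_through C f m)))"

text \<open>The union consists of all representatives of all classes in the family, so factoring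
  through each of its members amounts to lying below each class.\<close>

lemma (in category) intersection_is_glb:
  assumes "\<P> \<subseteq> carrier (Sub C X)" "intersection C X (\<Union>\<P>) k"
  shows "is_glb (Sub C X) (mono_equiv C X `` {k}) \<P>"
proof -
  let ?K = "mono_equiv C X `` {k}"
  have k: "k \<in> monos_into C X" and K: "?K \<in> carrier (Sub C X)" "k \<in> ?K"
    using assms(2) Sub_class_in[of k X] by (auto simp: intersection_def)
  have le: "le (Sub C X) Q ?K \<longleftrightarrow> (\<forall>P\<in>\<P>. le (Sub C X) Q P)" if Q: "Q \<in> carrier (Sub C X)" for Q
  proof -
    obtain f where f: "f \<in> Q" "f \<in> monos_into C X" using Q by (rule Sub_carrierE)
    have "le (Sub C X) Q ?K \<longleftrightarrow> factors_through C f k" using Sub_le_iff Q K f by blast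
    also have "\<dots> \<longleftrightarrow> (\<forall>m\<in>\<Union>\<P>. factors_through C f m)"
      using assms(2) f(2) by (auto simp: intersection_def monos_into_iff monic_arr)
    also have "\<dots> \<longleftrightarrow> (\<forall>P\<in>\<P>. le (Sub C X) Q P)"
      using Sub_le_iff[OF Q _ f(1)] assms(1) Sub_carrierE by (smt (verit) Union_iff subset_iff)
    finally show ?thesis .
  qed
  have "le (Sub C X) ?K ?K"
    using K Sub_le_iff k factors_through_refl by (auto simp: monos_into_iff monic_arr)
  \<comment> \<open>The equivalence at \<open>?K\<close> itself, with reflexivity, says that
    \<open>?K\<close> is a lower bound; at any other lower bound it says that \<open>?K\<close> is
    the greatest.\<close>
  with le[OF K(1)] le K(1) show ?thesis
    using assms(1) by (auto simp: greatest_def Lower_def)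
qed

text \<open>Two greatest lower bounds lie below each other, and mutually factoring representatives
  have the same class. The literal equality is what identifies the meet selected by the infimum
  operator with a constructed one.\<close>

lemma (in category) Sub_glb_unique:
  assumes "is_glb (Sub C X) P \<P>" "is_glb (Sub C X) Q \<P>"
  shows "P = Q"
proof -
  have P: "P \<in> carrier (Sub C X)" and Q: "Q \<in> carrier (Sub C X)"
    and le: "le (Sub C X) P Q" "le (Sub C X) Q P"
    using assms by (auto simp: greatest_def Lower_def)
  obtain m where m: "m \<in> P" "m \<in> monos_into C X" using P by (rule Sub_carrierE)
  obtain n where n: "n \<in> Q" "n \<in> monos_into C X" using Q by (rule Sub_carrierE)
  have "mono_equiv C X `` {m} = mono_equiv C X `` {n}"
    using le Sub_le_iff P Q m(1) n(1) by (subst Sub_class_eq_iff[OF m(2) n(2)]) blast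
  then show ?thesis using Sub_carrierD(2) P Q m(1) n(1) by metis
qed

section \<open>Zero arrows, kernels and cokernels\<close>

lemma Hom_opp: "Hom (opp C) X Y = Hom C Y X"
  by (auto simp: Hom_def opp_def)

lemma zero_object_opp: "zero_object (opp C) Z \<longleftrightarrow> zero_object C Z"
  by (auto simp: zero_object_def Hom_opp) (auto simp: opp_def)

lemma zero_arrow_opp: "zero_arrow (opp C) f \<longleftrightarrow> zero_arrow C f"
  by (simp add: zero_arrow_def zero_object_opp Hom_opp) (auto simp: opp_def)

text \<open>Zero arrows are self-dual, so the opposite category can be eliminated from the
  definition.\<close>

lemma is_cokernel_iff:
  "is_cokernel C f q \<longleftrightarrow>
     f \<in> Arr C \<and> q \<in> Arr C \<and> Dom C q = Cod C f \<and> zero_arrow C (q \<cdot>\<^bsub>C\<^esub> f) \<and>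
     (\<forall>g\<in>Arr C. Dom C g = Cod C f \<and> zero_arrow C (g \<cdot>\<^bsub>C\<^esub> f) \<longrightarrow>
        (\<exists>!h. h \<in> Hom C (Cod C q) (Cod C g) \<and> h \<cdot>\<^bsub>C\<^esub> q = g))"
  unfolding is_cokernel_def is_kernel_def zero_arrow_opp Hom_opp by (simp add: opp_def)

context category
begin

section \<open>Zero objects, zero arrows and kernels\<close>

lemma zero_objectE:
  assumes "zero_object C Z" "X \<in> Obj C"
  obtains f g where "f \<in> Arr C" "Dom C f = X" "Cod C f = Z" "g \<in> Arr C" "Dom C g = Z" "Cod C g = X"
  using assms by (fastforce simp: zero_object_def Hom_iff)

lemma zero_object_unique:
  assumes "zero_object C Z" "f \<in> Arr C" "g \<in> Arr C" "Dom C f = Dom C g" "Cod C f = Cod C g"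
    "Dom C g = Z \<or> Cod C g = Z"
  shows "f = g"
proof -
  have "Dom C g \<in> Obj C" "Cod C g \<in> Obj C" using assms by simp_all
  then show ?thesis using assms unfolding zero_object_def Hom_iff by metis
qed

lemma zero_arrowI:
  assumes "zero_object C Z" "g \<in> Arr C" "h \<in> Arr C" "Cod C g = Z" "Dom C h = Z"
  shows "zero_arrow C (h \<cdot> g)"
proof -
  have "g \<in> Hom C (Dom C (h \<cdot> g)) Z" "h \<in> Hom C Z (Cod C (h \<cdot> g))" "h \<cdot> g \<in> Arr C"
    using assms by (simp_all add: Hom_iff)
  then show ?thesis using assms(1) unfolding zero_arrow_def by blast
qed

lemma zero_arrow_arr: "zero_arrow C f \<Longrightarrow> f \<in> Arr C"
  by (simp add: zero_arrow_def)

text \<open>The definition offers some zero object depending on \<open>f\<close>; here the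
  factorization is moved to a prescribed one, so that several zero arrows can be compared over the
  same \<open>Z\<close>.\<close>

lemma zero_arrowE:
  assumes "zero_arrow C f" "zero_object C Z"
  obtains g h where "g \<in> Arr C" "h \<in> Arr C" "Dom C g = Dom C f" "Cod C g = Z" "Dom C h = Z"
    "Cod C h = Cod C f" "h \<cdot> g = f"
proof -
  obtain Z' g h where Z': "zero_object C Z'" and "g \<in> Hom C (Dom C f) Z'" "h \<in> Hom C Z' (Cod C f)"
    and f: "h \<cdot> g = f"
    using assms(1) unfolding zero_arrow_def by metis
  then have gh [simp]: "g \<in> Arr C" "h \<in> Arr C" "Dom C g = Dom C f" "Cod C g = Z'" "Dom C h = Z'"
    "Cod C h = Cod C f"
    by (auto simp: Hom_iff)
  have [simp]: "Z' \<in> Obj C" using Z' by (simp add: zero_object_def)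
  then obtain a b where ab [simp]: "a \<in> Arr C" "Dom C a = Z'" "Cod C a = Z" "b \<in> Arr C"
    "Dom C b = Z" "Cod C b = Z'"
    using zero_objectE[OF assms(2)] by blast
  \<comment> \<open>The only endo-arrow of a zero object is its identity, so \<open>b\<close> after
    \<open>a\<close> may be inserted between \<open>g\<close> and \<open>h\<close>.\<close>
  have "b \<cdot> a = Ident C Z'" by (rule zero_object_unique[OF Z']) auto
  then have "(h \<cdot> b) \<cdot> (a \<cdot> g) = f"
    using f by (simp add: comp_assoc) (simp flip: comp_assoc add: comp_assoc[of g a b])
  then show thesis by (rule that[rotated 6]) auto
qed

lemma zero_arrow_ex:
  assumes "zero_object C Z" "X \<in> Obj C" "Y \<in> Obj C"
  obtains f where "zero_arrow C f" "Dom C f = X" "Cod C f = Y"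
proof -
  obtain g where "g \<in> Arr C" "Dom C g = X" "Cod C g = Z"
    using zero_objectE[OF assms(1,2)] by blast
  moreover obtain h where "h \<in> Arr C" "Dom C h = Z" "Cod C h = Y"
    using zero_objectE[OF assms(1,3)] by blast
  ultimately show thesis
    using that[of "h \<cdot> g"] zero_arrowI[OF assms(1)] by simp
qed

lemma zero_arrow_unique:
  assumes "zero_arrow C f" "zero_arrow C g" "Dom C f = Dom C g" "Cod C f = Cod C g"
  shows "f = g"
proof -
  obtain Z where Z: "zero_object C Z" using assms(1) by (auto simp: zero_arrow_def)
  obtain a b where ab: "a \<in> Arr C" "b \<in> Arr C" "Dom C a = Dom C f" "Cod C a = Z" "Dom C b = Z"
    "Cod C b = Cod C f" "b \<cdot> a = f"
    using assms(1) Z by (rule zero_arrowE)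
  obtain c d where cd: "c \<in> Arr C" "d \<in> Arr C" "Dom C c = Dom C g" "Cod C c = Z" "Dom C d = Z"
    "Cod C d = Cod C g" "d \<cdot> c = g"
    using assms(2) Z by (rule zero_arrowE)
  have "a = c" "b = d"
    by (rule zero_object_unique[OF Z]; use ab cd assms in simp)+
  then show ?thesis using ab(7) cd(7) by simp
qed

lemma zero_comp:
  assumes "zero_arrow C f" "g \<in> Arr C" "Cod C f = Dom C g"
  shows "zero_arrow C (g \<cdot> f)"
proof -
  obtain Z where Z: "zero_object C Z" using assms(1) by (auto simp: zero_arrow_def)
  obtain a b where ab: "a \<in> Arr C" "b \<in> Arr C" "Dom C a = Dom C f" "Cod C a = Z" "Dom C b = Z"
    "Cod C b = Cod C f" "b \<cdot> a = f"
    using assms(1) Z by (rule zero_arrowE)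
  then have "(g \<cdot> b) \<cdot> a = g \<cdot> f" using assms by (simp add: comp_assoc)
  then show ?thesis using zero_arrowI[OF Z, of a "g \<cdot> b"] ab assms by simp
qed

lemma comp_zero:
  assumes "zero_arrow C g" "f \<in> Arr C" "Cod C f = Dom C g"
  shows "zero_arrow C (g \<cdot> f)"
proof -
  obtain Z where Z: "zero_object C Z" using assms(1) by (auto simp: zero_arrow_def)
  obtain a b where ab: "a \<in> Arr C" "b \<in> Arr C" "Dom C a = Dom C g" "Cod C a = Z" "Dom C b = Z"
    "Cod C b = Cod C g" "b \<cdot> a = g"
    using assms(1) Z by (rule zero_arrowE)
  then have "b \<cdot> (a \<cdot> f) = g \<cdot> f" using assms by (simp flip: comp_assoc)
  then show ?thesis using zero_arrowI[OF Z, of "a \<cdot> f" b] ab assms by simp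
qed

text \<open>The factor is the zero arrow into \<open>Dom C g\<close>: followed by \<open>g\<close>
  it is zero again, and parallel zero arrows coincide.\<close>

lemma zero_factors_through:
  assumes "zero_arrow C f" "g \<in> Arr C" "Cod C f = Cod C g"
  shows "factors_through C f g"
proof -
  obtain Z where Z: "zero_object C Z" using assms(1) by (auto simp: zero_arrow_def)
  obtain h where h: "zero_arrow C h" "Dom C h = Dom C f" "Cod C h = Dom C g"
    using zero_arrow_ex[OF Z, of "Dom C f" "Dom C g"] assms zero_arrow_arr by auto
  have "f = g \<cdot> h"
    by (rule zero_arrow_unique) (use h assms zero_arrow_arr zero_comp in auto)
  then show ?thesis using h zero_arrow_arr by (intro factors_throughI[of h]) auto
qed

text \<open>This is how kernels are used throughout: factorization through a mono becomes the
  vanishing of a composite, which can be handled by limits and by naturality.\<close>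

lemma kernel_factors:
  assumes "is_kernel C c k"
  shows "monic C k" "Cod C k = Dom C c"
    "\<lbrakk>f \<in> Arr C; Cod C f = Dom C c\<rbrakk> \<Longrightarrow> factors_through C f k \<longleftrightarrow> zero_arrow C (c \<cdot> f)"
proof -
  have k [simp]: "c \<in> Arr C" "k \<in> Arr C" "Cod C k = Dom C c" and ck: "zero_arrow C (c \<cdot> k)"
    and univ: "\<And>g. g \<in> Arr C \<Longrightarrow> Cod C g = Dom C c \<Longrightarrow> zero_arrow C (c \<cdot> g) \<Longrightarrow>
        (\<exists>!h. h \<in> Hom C (Dom C g) (Dom C k) \<and> k \<cdot> h = g)"
    using assms by (auto simp: is_kernel_def)
  have zero: "zero_arrow C (c \<cdot> (k \<cdot> f))" if "f \<in> Arr C" "Cod C f = Dom C k" for f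
    using comp_zero[OF ck, of f] that by (simp add: comp_assoc)
  show "Cod C k = Dom C c" by simp
  show "monic C k"
  proof (rule monicI)
    fix f g
    assume fg: "f \<in> Arr C" "g \<in> Arr C" "Dom C f = Dom C g" "Cod C f = Dom C k" "Cod C g = Dom C k"
      and eq: "k \<cdot> f = k \<cdot> g"
    have "\<exists>!h. h \<in> Hom C (Dom C (k \<cdot> g)) (Dom C k) \<and> k \<cdot> h = k \<cdot> g"
      by (rule univ) (use fg zero in auto)
    moreover have "f \<in> Hom C (Dom C (k \<cdot> g)) (Dom C k)" "g \<in> Hom C (Dom C (k \<cdot> g)) (Dom C k)"
      using fg by (auto simp: Hom_iff)
    ultimately show "f = g" using eq by blast
  qed simp
  show "factors_through C f k \<longleftrightarrow> zero_arrow C (c \<cdot> f)" if f: "f \<in> Arr C" "Cod C f = Dom C c"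
  proof
    assume "factors_through C f k"
    then show "zero_arrow C (c \<cdot> f)" using zero by (auto elim!: factors_throughE)
  next
    assume "zero_arrow C (c \<cdot> f)"
    from univ[OF f this] show "factors_through C f k" by (auto simp: factors_through_def)
  qed
qed

section \<open>Cokernels and the maps they induce\<close>

lemma cokernel_arr:
  assumes "is_cokernel C f q"
  shows "f \<in> Arr C" "q \<in> Arr C" "Dom C q = Cod C f" "zero_arrow C (q \<cdot> f)"
  using assms by (auto simp: is_cokernel_iff)

lemma cokernel_factor:
  assumes "is_cokernel C f q" "g \<in> Arr C" "Dom C g = Cod C f" "zero_arrow C (g \<cdot> f)"
  obtains h where "h \<in> Arr C" "Dom C h = Cod C q" "Cod C h = Cod C g" "h \<cdot> q = g"
  using assms unfolding is_cokernel_iff Hom_iff by blast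

text \<open>A cokernel is epic: \<open>h\<close> after \<open>q\<close> kills \<open>f\<close>, so
  the uniqueness clause applies to this arrow.\<close>

lemma cokernel_cancel:
  assumes "is_cokernel C f q" "g \<cdot> q = h \<cdot> q" "g \<in> Arr C" "h \<in> Arr C" "Dom C g = Cod C q"
    "Dom C h = Cod C q" "Cod C g = Cod C h"
  shows "g = h"
proof -
  note [simp] = cokernel_arr[OF assms(1)]
  have "zero_arrow C ((h \<cdot> q) \<cdot> f)"
    using zero_comp[of "q \<cdot> f" h] assms by (simp add: comp_assoc)
  then have "\<exists>!k. k \<in> Hom C (Cod C q) (Cod C (h \<cdot> q)) \<and> k \<cdot> q = h \<cdot> q"
    using assms(1,4,6) unfolding is_cokernel_iff by (metis cod_comp comp_arr dom_comp)
  moreover have "g \<in> Hom C (Cod C q) (Cod C (h \<cdot> q))" "h \<in> Hom C (Cod C q) (Cod C (h \<cdot> q))"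
    using assms by (simp_all add: Hom_iff)
  ultimately show ?thesis using assms(2) by blast
qed

text \<open>If \<open>s\<close> factors through \<open>s'\<close>, then \<open>q'\<close> kills
  \<open>s\<close> too and descends along \<open>q\<close>: a larger subobject has a smaller
  quotient.\<close>

lemma cokernel_map:
  assumes q: "is_cokernel C s q" "is_cokernel C s' q'" and le: "factors_through C s s'"
    and cod: "Cod C s = Cod C s'"
  obtains w where "w \<in> Arr C" "Dom C w = Cod C q" "Cod C w = Cod C q'" "w \<cdot> q = q'"
proof -
  note [simp] = cokernel_arr[OF q(1)] cokernel_arr[OF q(2)] cod
  obtain a where a: "a \<in> Arr C" "Dom C a = Dom C s" "Cod C a = Dom C s'" and s'a: "s' \<cdot> a = s"
    using le by (rule factors_throughE)
  have "zero_arrow C ((q' \<cdot> s') \<cdot> a)" using a by - (rule comp_zero, auto)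
  then have "zero_arrow C (q' \<cdot> s)" using a by (simp add: comp_assoc s'a)
  moreover have "Dom C q' = Cod C s" by simp
  ultimately show thesis
    using that cokernel_factor[OF q(1) cokernel_arr(2)[OF q(2)]] by blast
qed

end

section \<open>Abelian categories: preimages of monos, and monos recognized by their kernels\<close>

locale abelian = category +
  assumes abelian: "abelian_category C"
begin

lemma zero_object_ex: obtains Z where "zero_object C Z"
  using abelian by (auto simp: abelian_category_def)

lemma kernel_ex: assumes "f \<in> Arr C" obtains k where "is_kernel C f k"
  using abelian assms by (auto simp: abelian_category_def)

lemma cokernel_ex: assumes "f \<in> Arr C" obtains q where "is_cokernel C f q"
  using abelian assms by (auto simp: abelian_category_def)

lemma monic_kernel: assumes "monic C m" obtains f where "is_kernel C f m"
  using abelian assms by (auto simp: abelian_category_def)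

text \<open>If \<open>f\<close> is a kernel of \<open>c\<close>, the preimage of \<open>f\<close>
  along \<open>g\<close> is a kernel of \<open>c\<close> after \<open>g\<close>.\<close>

lemma monic_pullback_ex:
  assumes "monic C f" "g \<in> Arr C" "Cod C f = Cod C g"
  obtains p p' where "is_pullback C f g p p'"
proof -
  obtain c where c: "is_kernel C c f" using assms(1) by (rule monic_kernel)
  then have c' [simp]: "c \<in> Arr C" "Dom C c = Cod C g"
    using assms(3) by (auto simp: is_kernel_def)
  obtain p where p: "is_kernel C (c \<cdot> g) p" using kernel_ex[of "c \<cdot> g"] assms(2) by auto
  have "factors_through C u p \<longleftrightarrow> factors_through C (g \<cdot> u) f"
    if "u \<in> Arr C" "Cod C u = Dom C g" for u
    using kernel_factors(3)[OF p, of u] kernel_factors(3)[OF c, of "g \<cdot> u"] that assms(2)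
    by (simp add: comp_assoc)
  then show thesis
    using kernel_factors(1,2)[OF p] assms that monic_pullback_iff[OF assms, of p] by auto
qed

text \<open>The usual subtraction argument. It needs the additive structure, which otherwise stays
  hidden behind zero arrows and kernels.\<close>

lemma monicI_zero:
  assumes m [simp]: "m \<in> Arr C"
    and zero: "\<And>f. \<lbrakk>f \<in> Arr C; Cod C f = Dom C m; zero_arrow C (m \<cdot> f)\<rbrakk> \<Longrightarrow> zero_arrow C f"
  shows "monic C m"
proof (rule monicI)
  fix f g
  assume fg [simp]: "f \<in> Arr C" "g \<in> Arr C" "Dom C f = Dom C g" "Cod C f = Dom C m"
    "Cod C g = Dom C m" and eq: "m \<cdot> f = m \<cdot> g"
  obtain add where add: "preadditive C add"
    using abelian by (auto simp: abelian_category_def)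
  define grp where "grp X Y z = \<lparr>carrier = Hom C X Y, monoid.mult = add, one = z\<rparr>" for X Y z
  have grp_ex: "\<exists>z. comm_group (grp X Y z)" if "X \<in> Obj C" "Y \<in> Obj C" for X Y
    using add that by (simp add: preadditive_def grp_def)
  have bilin: "k \<cdot> add h h' = add (k \<cdot> h) (k \<cdot> h') \<and> add k k' \<cdot> h = add (k \<cdot> h) (k' \<cdot> h)"
    if "X \<in> Obj C" "Y \<in> Obj C" "Z \<in> Obj C" "h \<in> Hom C X Y" "h' \<in> Hom C X Y" "k \<in> Hom C Y Z"
      "k' \<in> Hom C Y Z" for X Y Z h h' k k'
    using add that unfolding preadditive_def by blast
  have distl: "k \<cdot> add h h' = add (k \<cdot> h) (k \<cdot> h')"
    if "h \<in> Arr C" "h' \<in> Arr C" "k \<in> Arr C" "Dom C h = Dom C h'" "Cod C h = Dom C k"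
      "Cod C h' = Dom C k" for h h' k
    using bilin[of "Dom C h'" "Dom C k" "Cod C k" h h' k k] that by (simp add: Hom_iff)
  have distr: "add k k' \<cdot> h = add (k \<cdot> h) (k' \<cdot> h)"
    if "h \<in> Arr C" "k' \<in> Arr C" "k \<in> Arr C" "Cod C h = Dom C k" "Dom C k = Dom C k'"
      "Cod C k = Cod C k'" for h k k'
    using bilin[of "Dom C h" "Dom C k'" "Cod C k'" h h k k'] that by (simp add: Hom_iff)
  \<comment> \<open>Zero arrows are defined through a zero object, while \<open>preadditive\<close>
    only provides some neutral element in each hom-group; the two notions have to be
    matched.\<close>
  have neutral: "zero_arrow C h \<longleftrightarrow> h = z"
    if G: "comm_group (grp X Y z)" and h: "h \<in> Hom C X Y" for X Y z h
  proof -
    interpret G: comm_group "grp X Y z" by (rule G)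
    have XY: "X \<in> Obj C" "Y \<in> Obj C" using h by (auto simp: Hom_iff)
    obtain Z where Z: "zero_object C Z" by (rule zero_object_ex)
    then have ZO [simp]: "Z \<in> Obj C" by (simp add: zero_object_def)
    obtain w where w: "zero_arrow C w" "Dom C w = X" "Cod C w = Y"
      using Z XY by (rule zero_arrow_ex)
    obtain a b where ab [simp]: "a \<in> Arr C" "b \<in> Arr C" "Dom C a = X" "Cod C a = Z" "Dom C b = Z"
      "Cod C b = Y" and w': "b \<cdot> a = w"
      using zero_arrowE[OF w(1) Z] w(2,3) by metis
    obtain z' where "comm_group (grp Z Y z')" using grp_ex XY(2) ZO by blast
    then interpret H: comm_group "grp Z Y z'" .
    \<comment> \<open>There is only one arrow from \<open>Z\<close> to \<open>Y\<close>, so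
      \<open>b\<close> is idempotent under \<open>add\<close>. Precomposing with \<open>a\<close>
      makes \<open>w\<close> idempotent, hence neutral by cancellation.\<close>
    have "add b b \<in> Hom C Z Y" using H.m_closed[of b b] by (simp add: grp_def Hom_iff)
    then have "add b b = b" by (intro zero_object_unique[OF Z]) (auto simp: Hom_iff)
    then have "add w w = w" using distr[of a b b] by (simp add: w')
    moreover have "w \<in> carrier (grp X Y z)"
      using w by (simp add: grp_def Hom_iff zero_arrow_arr)
    ultimately have "w = z"
      using G.r_cancel_one[of w w] by (simp add: grp_def)
    moreover have "zero_arrow C h \<longleftrightarrow> h = w"
      using zero_arrow_unique[OF _ w(1), of h] h w by (auto simp: Hom_iff)
    ultimately show ?thesis by simp
  qed
  let ?W = "Dom C g" and ?X = "Dom C m" and ?Y = "Cod C m"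
  obtain z where "comm_group (grp ?W ?X z)" using grp_ex[of ?W ?X] by auto
  then interpret G: comm_group "grp ?W ?X z" .
  obtain y where "comm_group (grp ?W ?Y y)" using grp_ex[of ?W ?Y] by auto
  then interpret H: comm_group "grp ?W ?Y y" .
  have FG: "f \<in> carrier (grp ?W ?X z)" "g \<in> carrier (grp ?W ?X z)"
    by (auto simp: grp_def Hom_iff)
  \<comment> \<open>\<open>d\<close> is the difference of \<open>f\<close> and \<open>g\<close>. As
    \<open>f\<close> is the sum of \<open>d\<close> and \<open>g\<close>, biadditivity and the
    equality of the two composites with \<open>m\<close> force \<open>m\<close> after
    \<open>d\<close> to vanish.\<close>
  define d where "d = f \<otimes>\<^bsub>grp ?W ?X z\<^esub> inv\<^bsub>grp ?W ?X z\<^esub> g"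
  have D: "d \<in> carrier (grp ?W ?X z)" unfolding d_def by (intro G.m_closed G.inv_closed FG)
  then have d [simp]: "d \<in> Arr C" "Dom C d = ?W" "Cod C d = ?X" by (auto simp: grp_def Hom_iff)
  have "d \<otimes>\<^bsub>grp ?W ?X z\<^esub> g = f" using FG by (simp add: d_def G.m_assoc)
  then have f: "add d g = f" by (simp add: grp_def)
  have md: "m \<cdot> d \<in> carrier (grp ?W ?Y y)" "m \<cdot> g \<in> carrier (grp ?W ?Y y)"
    by (auto simp: grp_def Hom_iff)
  have "add (m \<cdot> d) (m \<cdot> g) = m \<cdot> g" using distl[of d g m] by (simp add: f eq)
  then have "m \<cdot> d = y" using H.l_cancel_one[OF md(2,1)] H.r_cancel_one[of "m \<cdot> g" "m \<cdot> d"] md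
    by (simp add: grp_def)
  then have "zero_arrow C (m \<cdot> d)"
    using neutral[OF H.comm_group_axioms] md by (simp add: grp_def)
  then have "zero_arrow C d" by (intro zero[of d]) auto
  then have "d = z" using neutral[OF G.comm_group_axioms] D by (simp add: grp_def)
  then show "f = g" using f G.l_one[OF FG(2)] by (simp add: grp_def)
qed simp

end

section \<open>Intersections of classes of subobjects\<close>

context category
begin

text \<open>Completeness speaks of index categories over the type \<open>'u\<close>, whereas
  \<open>K\<close> lives in any type. Smallness gives an injection \<open>e\<close> into
  \<open>'u\<close>, and the product is the limit over the discrete category on the image of
  \<open>e\<close>.\<close>

lemma product_ex:
  fixes Q :: "'k \<Rightarrow> 'o"
  assumes complete: "complete_category TYPE('u) C" and K: "small TYPE('u) K"
    and Q: "\<And>k. k \<in> K \<Longrightarrow> Q k \<in> Obj C"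
  obtains P \<pi> where "P \<in> Obj C" "\<And>k. k \<in> K \<Longrightarrow> \<pi> k \<in> Hom C P (Q k)"
    "\<And>Y \<psi>. \<lbrakk>Y \<in> Obj C; \<And>k. k \<in> K \<Longrightarrow> \<psi> k \<in> Hom C Y (Q k)\<rbrakk> \<Longrightarrow>
      \<exists>!h. h \<in> Hom C Y P \<and> (\<forall>k\<in>K. \<pi> k \<cdot> h = \<psi> k)"
proof -
  obtain e :: "'k \<Rightarrow> 'u" where e: "inj_on e K"
    using K by (auto simp: small_def lesspoll_def lepoll_def)
  define d where "d = inv_into K e"
  have d [simp]: "d (e k) = k" if "k \<in> K" for k using e that by (simp add: d_def)
  \<comment> \<open>Objects and identity arrows are the same elements of \<open>'u\<close>. Functors
    out of \<open>J\<close> are therefore families of objects, and cones are families of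
    arrows.\<close>
  define J :: "('u, 'u) cat" where
    "J = \<lparr>Obj = e ` K, Arr = e ` K, Dom = id, Cod = id, Ident = id, Comp = (\<lambda>g f. f)\<rparr>"
  have HomJ: "Hom J i j = (if i = j \<and> j \<in> e ` K then {j} else {})" for i j
    by (auto simp: Hom_def J_def)
  have "category J"
    by (rule category.intro) (simp_all add: HomJ split: if_splits, simp_all add: J_def)
  moreover have "e ` K \<approx> K" using e by (simp add: inj_on_image_eqpoll_self)
  then have "small TYPE('u) (e ` K)"
    using K unfolding small_def by (meson eq_lesspoll_trans)
  then have "small TYPE('u) (Obj J)" "small TYPE('u) (Arr J)" by (simp_all add: J_def)
  moreover define D where
    "D = \<lparr>FObj = restrict (\<lambda>j. Q (d j)) (e ` K), FArr = restrict (\<lambda>j. Ident C (Q (d j))) (e ` K)\<rparr>"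
  have "is_functor J C D"
    unfolding is_functor_def HomJ using Q
    by (auto simp: D_def Hom_iff J_def split: if_splits)
  ultimately obtain P \<pi> where lim: "is_limit J C D P \<pi>"
    using complete unfolding complete_category_def by blast
  have cone_iff: "is_cone J C D Y (\<lambda>j. \<psi> (d j)) \<longleftrightarrow> Y \<in> Obj C \<and> (\<forall>k\<in>K. \<psi> k \<in> Hom C Y (Q k))" for Y \<psi>
    unfolding is_cone_def HomJ by (auto simp: D_def J_def Hom_iff split: if_splits)
  show thesis
  proof (rule that[of P "\<lambda>k. \<pi> (e k)"])
    show "P \<in> Obj C" using lim by (simp add: is_limit_def is_cone_def)
    show "\<pi> (e k) \<in> Hom C P (Q k)" if "k \<in> K" for k
      using lim that by (auto simp: is_limit_def is_cone_def J_def D_def)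
    show "\<exists>!h. h \<in> Hom C Y P \<and> (\<forall>k\<in>K. \<pi> (e k) \<cdot> h = \<psi> k)"
      if "Y \<in> Obj C" "\<And>k. k \<in> K \<Longrightarrow> \<psi> k \<in> Hom C Y (Q k)" for Y \<psi>
    proof -
      have "is_cone J C D Y (\<lambda>j. \<psi> (d j))" using that by (simp add: cone_iff)
      then have "\<exists>!h. h \<in> Hom C Y P \<and> (\<forall>j\<in>Obj J. \<pi> j \<cdot> h = \<psi> (d j))"
        using lim by (simp add: is_limit_def)
      then show ?thesis by (simp add: J_def)
    qed
  qed
qed

end

text \<open>\<open>M\<close> may be large, but local smallness bounds the set \<open>K\<close> of
  subobject classes it meets. Writing each class as the kernel of an arrow \<open>c P\<close>, an
  arrow into \<open>X\<close> lies in all of them iff all its composites with the \<open>c P\<close>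
  vanish, that is, iff its composite with the induced map \<open>h\<close> into the product
  vanishes.\<close>

lemma (in abelian) intersection_ex:
  assumes complete: "complete_category TYPE('u) C" and small: "locally_small TYPE('u) C"
    and X [simp]: "X \<in> Obj C" and M: "M \<subseteq> monos_into C X"
  obtains k where "intersection C X M k"
proof -
  define K where "K = (\<lambda>m. mono_equiv C X `` {m}) ` M"
  have KM: "P \<in> carrier (Sub C X)" if "P \<in> K" for P
    using that M Sub_class_in by (auto simp: K_def)
  have K: "small TYPE('u) K"
  proof -
    have "K \<lesssim> carrier (Sub C X)" using KM by (intro subset_imp_lepoll) auto
    then show ?thesis
      using small X unfolding locally_small_def small_def by (meson lesspoll_trans1)
  qed
  \<comment> \<open>One representative and one arrow are chosen per class rather than per mono; this
    keeps the product small.\<close>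
  have "\<exists>c m. m \<in> P \<and> m \<in> monos_into C X \<and> is_kernel C c m" if P: "P \<in> K" for P
  proof -
    obtain m where m: "m \<in> P" "m \<in> monos_into C X" using KM[OF P] by (rule Sub_carrierE)
    obtain c where "is_kernel C c m" using m(2) monic_kernel[of m] by (auto simp: monos_into_iff)
    with m show ?thesis by blast
  qed
  then obtain c r where r: "\<And>P. P \<in> K \<Longrightarrow> r P \<in> P" "\<And>P. P \<in> K \<Longrightarrow> r P \<in> monos_into C X"
    and c: "\<And>P. P \<in> K \<Longrightarrow> is_kernel C (c P) (r P)"
    by metis
  have carr [simp]: "c P \<in> Arr C" "Dom C (c P) = X" if "P \<in> K" for P
    using c[OF that] r(2)[OF that] by (auto simp: is_kernel_def monos_into_iff)
  have all_iff: "(\<forall>m\<in>M. factors_through C f m) \<longleftrightarrow> (\<forall>P\<in>K. zero_arrow C (c P \<cdot> f))"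
    if f: "f \<in> Arr C" "Cod C f = X" for f
  proof -
    have "factors_through C f m \<longleftrightarrow> zero_arrow C (c (mono_equiv C X `` {m}) \<cdot> f)"
      if m: "m \<in> M" for m
    proof -
      let ?P = "mono_equiv C X `` {m}"
      have P: "?P \<in> K" using m by (simp add: K_def)
      have "(m, r ?P) \<in> mono_equiv C X" using r(1)[OF P] by simp
      then have "factors_through C f m \<longleftrightarrow> factors_through C f (r ?P)"
        using factors_through_trans[of f m "r ?P"] factors_through_trans[of f "r ?P" m]
        by (auto simp: mono_equiv_def monos_into_iff monic_arr)
      then show ?thesis using kernel_factors(3)[OF c[OF P], of f] f P by simp
    qed
    then show ?thesis by (auto simp: K_def)
  qed
  have Q: "Cod C (c k) \<in> Obj C" if "k \<in> K" for k using that by simp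
  obtain P \<pi> where P: "P \<in> Obj C" and \<pi>: "\<And>k. k \<in> K \<Longrightarrow> \<pi> k \<in> Hom C P (Cod C (c k))"
    and univ: "\<And>Y \<psi>. \<lbrakk>Y \<in> Obj C; \<And>k. k \<in> K \<Longrightarrow> \<psi> k \<in> Hom C Y (Cod C (c k))\<rbrakk> \<Longrightarrow>
      \<exists>!h. h \<in> Hom C Y P \<and> (\<forall>k\<in>K. \<pi> k \<cdot> h = \<psi> k)"
    using product_ex[OF complete K, where Q = "\<lambda>k. Cod C (c k)", OF Q] by blast
  have \<pi>' [simp]: "\<pi> k \<in> Arr C" "Dom C (\<pi> k) = P" "Cod C (\<pi> k) = Cod C (c k)" if "k \<in> K" for k
    using \<pi>[OF that] by (auto simp: Hom_iff)
  obtain h where h [simp]: "h \<in> Arr C" "Dom C h = X" "Cod C h = P"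
    and \<pi>h: "\<And>k. k \<in> K \<Longrightarrow> \<pi> k \<cdot> h = c k"
    using univ[of X c] by (auto simp: Hom_iff)
  obtain n where n: "is_kernel C h n" by (rule kernel_ex[OF h(1)])
  have "zero_arrow C (h \<cdot> f) \<longleftrightarrow> (\<forall>k\<in>K. zero_arrow C (c k \<cdot> f))"
    if f [simp]: "f \<in> Arr C" "Cod C f = X" for f
  proof
    assume z: "zero_arrow C (h \<cdot> f)"
    show "\<forall>k\<in>K. zero_arrow C (c k \<cdot> f)"
    proof
      fix k assume k: "k \<in> K"
      have "zero_arrow C (\<pi> k \<cdot> (h \<cdot> f))" by (rule zero_comp[OF z]) (use k in simp_all)
      then show "zero_arrow C (c k \<cdot> f)" using k by (simp add: \<pi>h flip: comp_assoc)
    qed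
  next
    assume z: "\<forall>k\<in>K. zero_arrow C (c k \<cdot> f)"
    \<comment> \<open>The zero arrow \<open>w\<close> and the composite of \<open>h\<close> with
      \<open>f\<close> have the same projections, so uniqueness in the product makes them
      equal.\<close>
    obtain Z where "zero_object C Z" by (rule zero_object_ex)
    then obtain w where w: "zero_arrow C w" "Dom C w = Dom C f" "Cod C w = P"
      using zero_arrow_ex[of Z "Dom C f" P] P by auto
    have "\<pi> k \<cdot> w = c k \<cdot> f" if "k \<in> K" for k
      by (rule zero_arrow_unique) (use that w z zero_arrow_arr[OF w(1)] zero_comp[OF w(1)] in auto)
    moreover have "\<pi> k \<cdot> (h \<cdot> f) = c k \<cdot> f" if "k \<in> K" for k
      using that by (simp add: \<pi>h flip: comp_assoc)
    moreover have "\<exists>!u. u \<in> Hom C (Dom C f) P \<and> (\<forall>k\<in>K. \<pi> k \<cdot> u = c k \<cdot> f)"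
      by (rule univ) (auto simp: Hom_iff)
    moreover have "w \<in> Hom C (Dom C f) P" "h \<cdot> f \<in> Hom C (Dom C f) P"
      using w zero_arrow_arr by (auto simp: Hom_iff)
    ultimately have "h \<cdot> f = w" by blast
    then show "zero_arrow C (h \<cdot> f)" using w(1) by simp
  qed
  then have "intersection C X M n"
    using kernel_factors[OF n] by (auto simp: intersection_def monos_into_iff all_iff)
  then show thesis by (rule that)
qed

section \<open>Functor categories\<close>

lemma functor_category_simps [simp]:
  "Obj (functor_category C D) = {F. is_functor C D F}"
  "Arr (functor_category C D) = {\<eta>. is_ntrans C D \<eta>}"
  "Dom (functor_category C D) = NDom"
  "Cod (functor_category C D) = NCod"
  "Ident (functor_category C D) F =
    \<lparr>NDom = F, NCod = F, NMap = (\<lambda>X\<in>Obj C. Ident D (FObj F X))\<rparr>"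
  "Comp (functor_category C D) \<theta> \<eta> =
    \<lparr>NDom = NDom \<eta>, NCod = NCod \<theta>, NMap = (\<lambda>X\<in>Obj C. NMap \<theta> X \<cdot>\<^bsub>D\<^esub> NMap \<eta> X)\<rparr>"
  by (simp_all add: functor_category_def)

section \<open>Functors and natural transformations as a category\<close>

locale functor_cat = C: category C + D: category D
  for C :: "('a, 'b) cat" and D :: "('o, 'm) cat"
begin

lemma functor_simps [simp]:
  assumes "is_functor C D F"
  shows "X \<in> Obj C \<Longrightarrow> FObj F X \<in> Obj D"
    and "f \<in> Arr C \<Longrightarrow> FArr F f \<in> Arr D"
    and "f \<in> Arr C \<Longrightarrow> Dom D (FArr F f) = FObj F (Dom C f)"
    and "f \<in> Arr C \<Longrightarrow> Cod D (FArr F f) = FObj F (Cod C f)"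
    and "X \<in> Obj C \<Longrightarrow> FArr F (Ident C X) = Ident D (FObj F X)"
  using assms by (auto simp: is_functor_def Hom_iff)

lemma functor_comp:
  assumes "is_functor C D F" "f \<in> Arr C" "g \<in> Arr C" "Cod C f = Dom C g"
  shows "FArr F (g \<cdot>\<^bsub>C\<^esub> f) = FArr F g \<cdot>\<^bsub>D\<^esub> FArr F f"
  using assms unfolding is_functor_def by (auto simp: Hom_iff)

lemma ntrans_functor [simp]:
  assumes "is_ntrans C D \<eta>"
  shows "is_functor C D (NDom \<eta>)" "is_functor C D (NCod \<eta>)"
  using assms by (auto simp: is_ntrans_def)

lemma ntrans_simps [simp]:
  assumes "is_ntrans C D \<eta>" "X \<in> Obj C"
  shows "NMap \<eta> X \<in> Arr D" "Dom D (NMap \<eta> X) = FObj (NDom \<eta>) X"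
    "Cod D (NMap \<eta> X) = FObj (NCod \<eta>) X"
  using assms unfolding is_ntrans_def Hom_iff by blast+

lemma ntrans_natural:
  assumes "is_ntrans C D \<eta>" "f \<in> Arr C"
  shows "NMap \<eta> (Cod C f) \<cdot>\<^bsub>D\<^esub> FArr (NDom \<eta>) f = FArr (NCod \<eta>) f \<cdot>\<^bsub>D\<^esub> NMap \<eta> (Dom C f)"
proof -
  have "f \<in> Hom C (Dom C f) (Cod C f)" using assms(2) by (simp add: Hom_iff)
  with assms(1) show ?thesis unfolding is_ntrans_def by blast
qed

lemma ntransI:
  assumes "is_functor C D (NDom \<eta>)" "is_functor C D (NCod \<eta>)" "NMap \<eta> \<in> extensional (Obj C)"
    and "\<And>X. X \<in> Obj C \<Longrightarrow> NMap \<eta> X \<in> Hom D (FObj (NDom \<eta>) X) (FObj (NCod \<eta>) X)"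
    and "\<And>f. f \<in> Arr C \<Longrightarrow>
      NMap \<eta> (Cod C f) \<cdot>\<^bsub>D\<^esub> FArr (NDom \<eta>) f = FArr (NCod \<eta>) f \<cdot>\<^bsub>D\<^esub> NMap \<eta> (Dom C f)"
  shows "is_ntrans C D \<eta>"
proof -
  have "NMap \<eta> Y \<cdot>\<^bsub>D\<^esub> FArr (NDom \<eta>) f = FArr (NCod \<eta>) f \<cdot>\<^bsub>D\<^esub> NMap \<eta> X"
    if "f \<in> Hom C X Y" for f X Y
    using that assms(5)[of f] by (auto simp: Hom_def)
  then show ?thesis unfolding is_ntrans_def using assms(1-4) by blast
qed

lemma ntrans_extensional: "is_ntrans C D \<eta> \<Longrightarrow> NMap \<eta> \<in> extensional (Obj C)"
  unfolding is_ntrans_def by blast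

lemma ntrans_eqI:
  assumes "is_ntrans C D \<eta>" "is_ntrans C D \<theta>" "NDom \<eta> = NDom \<theta>" "NCod \<eta> = NCod \<theta>"
    "\<And>X. X \<in> Obj C \<Longrightarrow> NMap \<eta> X = NMap \<theta> X"
  shows "\<eta> = \<theta>"
proof -
  have "NMap \<eta> = NMap \<theta>"
    using ntrans_extensional[OF assms(1)] ntrans_extensional[OF assms(2)] assms(5)
    by (rule extensionalityI)
  then show ?thesis using assms(3,4) by simp
qed

lemma ntrans_ident:
  assumes "is_functor C D F"
  shows "is_ntrans C D \<lparr>NDom = F, NCod = F, NMap = (\<lambda>X\<in>Obj C. Ident D (FObj F X))\<rparr>"
  using assms by (intro ntransI) (auto simp: Hom_iff)

lemma ntrans_comp:
  assumes [simp]: "is_ntrans C D \<eta>" "is_ntrans C D \<theta>" and comp: "NCod \<eta> = NDom \<theta>"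
  shows "is_ntrans C D \<lparr>NDom = NDom \<eta>, NCod = NCod \<theta>,
    NMap = (\<lambda>X\<in>Obj C. NMap \<theta> X \<cdot>\<^bsub>D\<^esub> NMap \<eta> X)\<rparr>"
proof (rule ntransI)
  fix f assume f [simp]: "f \<in> Arr C"
  let ?X = "Dom C f" and ?Y = "Cod C f"
  have "(NMap \<theta> ?Y \<cdot>\<^bsub>D\<^esub> NMap \<eta> ?Y) \<cdot>\<^bsub>D\<^esub> FArr (NDom \<eta>) f =
      NMap \<theta> ?Y \<cdot>\<^bsub>D\<^esub> (FArr (NDom \<theta>) f \<cdot>\<^bsub>D\<^esub> NMap \<eta> ?X)"
    using ntrans_natural[of \<eta> f] by (simp add: D.comp_assoc comp)
  also have "\<dots> = (NMap \<theta> ?Y \<cdot>\<^bsub>D\<^esub> FArr (NDom \<theta>) f) \<cdot>\<^bsub>D\<^esub> NMap \<eta> ?X"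
    by (simp add: D.comp_assoc comp)
  also have "\<dots> = FArr (NCod \<theta>) f \<cdot>\<^bsub>D\<^esub> (NMap \<theta> ?X \<cdot>\<^bsub>D\<^esub> NMap \<eta> ?X)"
    by (simp add: ntrans_natural D.comp_assoc comp)
  finally show "NMap \<lparr>NDom = NDom \<eta>, NCod = NCod \<theta>,
      NMap = (\<lambda>X\<in>Obj C. NMap \<theta> X \<cdot>\<^bsub>D\<^esub> NMap \<eta> X)\<rparr> ?Y \<cdot>\<^bsub>D\<^esub> FArr (NDom \<lparr>NDom = NDom \<eta>, NCod = NCod \<theta>,
      NMap = (\<lambda>X\<in>Obj C. NMap \<theta> X \<cdot>\<^bsub>D\<^esub> NMap \<eta> X)\<rparr>) f =
    FArr (NCod \<lparr>NDom = NDom \<eta>, NCod = NCod \<theta>,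
      NMap = (\<lambda>X\<in>Obj C. NMap \<theta> X \<cdot>\<^bsub>D\<^esub> NMap \<eta> X)\<rparr>) f \<cdot>\<^bsub>D\<^esub> NMap \<lparr>NDom = NDom \<eta>, NCod = NCod \<theta>,
      NMap = (\<lambda>X\<in>Obj C. NMap \<theta> X \<cdot>\<^bsub>D\<^esub> NMap \<eta> X)\<rparr> ?X" by simp
qed (auto simp: Hom_iff comp)

text \<open>All general facts about arrows, monos, pullbacks and subobjects become available for
  transformations. The unit laws hold as equalities because components are extensional.\<close>

sublocale FC: category "functor_category C D"
proof (rule category.intro, unfold Hom_iff)
  fix f X Y
  assume "f \<in> Arr (functor_category C D) \<and> Dom (functor_category C D) f = X \<and>
    Cod (functor_category C D) f = Y"
  then have f [simp]: "is_ntrans C D f" "NDom f = X" "NCod f = Y" by auto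
  then have XY [simp]: "is_functor C D X" "is_functor C D Y" using ntrans_functor[of f] by auto
  have nt: "is_ntrans C D (Ident (functor_category C D) Y \<cdot>\<^bsub>functor_category C D\<^esub> f)"
    "is_ntrans C D (f \<cdot>\<^bsub>functor_category C D\<^esub> Ident (functor_category C D) X)"
    unfolding functor_category_simps by (rule ntrans_comp; simp add: ntrans_ident)+
  show "Ident (functor_category C D) Y \<cdot>\<^bsub>functor_category C D\<^esub> f = f"
    using nt(1) f(1) by (rule ntrans_eqI) simp_all
  show "f \<cdot>\<^bsub>functor_category C D\<^esub> Ident (functor_category C D) X = f"
    using nt(2) f(1) by (rule ntrans_eqI) simp_all
next
  fix f g h W X Y Z
  assume "f \<in> Arr (functor_category C D) \<and> Dom (functor_category C D) f = W \<and>
      Cod (functor_category C D) f = X"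
    and "g \<in> Arr (functor_category C D) \<and> Dom (functor_category C D) g = X \<and>
      Cod (functor_category C D) g = Y"
    and "h \<in> Arr (functor_category C D) \<and> Dom (functor_category C D) h = Y \<and>
      Cod (functor_category C D) h = Z"
  then show "(h \<cdot>\<^bsub>functor_category C D\<^esub> g) \<cdot>\<^bsub>functor_category C D\<^esub> f =
      h \<cdot>\<^bsub>functor_category C D\<^esub> (g \<cdot>\<^bsub>functor_category C D\<^esub> f)"
    by (auto intro!: restrict_ext simp: D.comp_assoc)
qed (auto simp: ntrans_ident ntrans_comp)

lemma NMap_comp:
  "\<lbrakk>\<theta> \<cdot>\<^bsub>functor_category C D\<^esub> h = \<eta>; X \<in> Obj C\<rbrakk> \<Longrightarrow> NMap \<eta> X = NMap \<theta> X \<cdot>\<^bsub>D\<^esub> NMap h X"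
  by (drule sym) simp

section \<open>Pointwise factorization and subfunctors\<close>

lemma factors_through_pointwise:
  assumes "factors_through (functor_category C D) \<eta> \<theta>" "X \<in> Obj C" "is_ntrans C D \<theta>"
  shows "factors_through D (NMap \<eta> X) (NMap \<theta> X)"
proof -
  obtain h where h: "is_ntrans C D h" "NDom h = NDom \<eta>" "NCod h = NDom \<theta>"
    "\<theta> \<cdot>\<^bsub>functor_category C D\<^esub> h = \<eta>"
    using assms(1) by (rule FC.factors_throughE) simp
  note NMap_comp[OF h(4) assms(2)]
  with h(1-3) assms(2,3) show ?thesis
    by (intro D.factors_throughI[of "NMap h X"]) auto
qed

text \<open>Factors through monic components are unique, and this uniqueness makes independently
  chosen ones natural.\<close>

lemma factors_throughI_pointwise:
  assumes [simp]: "is_ntrans C D \<eta>" "is_ntrans C D \<theta>" and cod [simp]: "NCod \<eta> = NCod \<theta>"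
    and monic: "\<And>X. X \<in> Obj C \<Longrightarrow> monic D (NMap \<theta> X)"
    and fac: "\<And>X. X \<in> Obj C \<Longrightarrow> factors_through D (NMap \<eta> X) (NMap \<theta> X)"
  shows "factors_through (functor_category C D) \<eta> \<theta>"
proof -
  have "\<exists>h. h \<in> Arr D \<and> Dom D h = FObj (NDom \<eta>) X \<and> Cod D h = FObj (NDom \<theta>) X \<and>
      NMap \<theta> X \<cdot>\<^bsub>D\<^esub> h = NMap \<eta> X" if "X \<in> Obj C" for X
    using fac[OF that] that by (auto elim!: D.factors_throughE)
  then obtain h where h: "\<And>X. X \<in> Obj C \<Longrightarrow> h X \<in> Arr D \<and> Dom D (h X) = FObj (NDom \<eta>) X \<and>
      Cod D (h X) = FObj (NDom \<theta>) X \<and> NMap \<theta> X \<cdot>\<^bsub>D\<^esub> h X = NMap \<eta> X"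
    by metis
  then have h' [simp]: "h X \<in> Arr D" "Dom D (h X) = FObj (NDom \<eta>) X"
      "Cod D (h X) = FObj (NDom \<theta>) X" "NMap \<theta> X \<cdot>\<^bsub>D\<^esub> h X = NMap \<eta> X" if "X \<in> Obj C" for X
    using that by auto
  let ?h = "\<lparr>NDom = NDom \<eta>, NCod = NDom \<theta>, NMap = restrict h (Obj C)\<rparr>"
  have nt: "is_ntrans C D ?h"
  proof (rule ntransI)
    fix f assume f [simp]: "f \<in> Arr C"
    let ?X = "Dom C f" and ?Y = "Cod C f"
    \<comment> \<open>The naturality square for \<open>h\<close> is checked after the mono
      \<open>NMap \<theta> ?Y\<close>, where it follows from naturality of \<eta> and
      \<theta>.\<close>
    have "NMap \<theta> ?Y \<cdot>\<^bsub>D\<^esub> (h ?Y \<cdot>\<^bsub>D\<^esub> FArr (NDom \<eta>) f) = NMap \<eta> ?Y \<cdot>\<^bsub>D\<^esub> FArr (NDom \<eta>) f"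
      by (simp flip: D.comp_assoc)
    also have "\<dots> = FArr (NCod \<eta>) f \<cdot>\<^bsub>D\<^esub> NMap \<eta> ?X"
      by (simp only: ntrans_natural[OF assms(1) f])
    also have "\<dots> = FArr (NCod \<theta>) f \<cdot>\<^bsub>D\<^esub> (NMap \<theta> ?X \<cdot>\<^bsub>D\<^esub> h ?X)" by simp
    also have "\<dots> = (NMap \<theta> ?Y \<cdot>\<^bsub>D\<^esub> FArr (NDom \<theta>) f) \<cdot>\<^bsub>D\<^esub> h ?X"
      using ntrans_natural[OF assms(2) f] by (simp del: h'(4) flip: D.comp_assoc)
    also have "\<dots> = NMap \<theta> ?Y \<cdot>\<^bsub>D\<^esub> (FArr (NDom \<theta>) f \<cdot>\<^bsub>D\<^esub> h ?X)"
      by (simp add: D.comp_assoc)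
    finally have "h ?Y \<cdot>\<^bsub>D\<^esub> FArr (NDom \<eta>) f = FArr (NDom \<theta>) f \<cdot>\<^bsub>D\<^esub> h ?X"
      by (rule D.monic_cancel[OF monic, rotated]) auto
    then show "NMap ?h ?Y \<cdot>\<^bsub>D\<^esub> FArr (NDom ?h) f = FArr (NCod ?h) f \<cdot>\<^bsub>D\<^esub> NMap ?h ?X" by simp
  qed (auto simp: Hom_iff)
  have "\<eta> = \<theta> \<cdot>\<^bsub>functor_category C D\<^esub> ?h"
    by (rule ntrans_eqI) (use nt ntrans_comp[of ?h \<theta>] in auto)
  then show ?thesis using nt by (intro FC.factors_throughI[of ?h]) auto
qed

lemma monicI_pointwise:
  assumes "is_ntrans C D \<eta>" "\<And>X. X \<in> Obj C \<Longrightarrow> monic D (NMap \<eta> X)"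
  shows "monic (functor_category C D) \<eta>"
proof (rule FC.monicI)
  fix f g
  assume "f \<in> Arr (functor_category C D)" "g \<in> Arr (functor_category C D)"
    "Dom (functor_category C D) f = Dom (functor_category C D) g"
    "Cod (functor_category C D) f = Dom (functor_category C D) \<eta>"
    "Cod (functor_category C D) g = Dom (functor_category C D) \<eta>"
    and eq: "\<eta> \<cdot>\<^bsub>functor_category C D\<^esub> f = \<eta> \<cdot>\<^bsub>functor_category C D\<^esub> g"
  then have fg: "is_ntrans C D f" "is_ntrans C D g" "NDom f = NDom g" "NCod f = NDom \<eta>"
    "NCod g = NDom \<eta>" by auto
  show "f = g"
  proof (rule ntrans_eqI[OF fg(1-3)])
    fix X assume X: "X \<in> Obj C"
    have "NMap \<eta> X \<cdot>\<^bsub>D\<^esub> NMap f X = NMap \<eta> X \<cdot>\<^bsub>D\<^esub> NMap g X"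
      using arg_cong[OF eq, of "\<lambda>\<theta>. NMap \<theta> X"] X by simp
    with assms(2)[OF X] show "NMap f X = NMap g X"
      by (rule D.monic_cancel) (use fg assms X in simp_all)
  qed (use fg in simp)
qed (use assms in simp)

text \<open>The restrictions of \<open>FArr G f\<close> to the subobjects \<open>k X\<close> are
  unique because the \<open>k X\<close> are monic, and so they respect identities and composition.
  Kernels, preimages and intersections of transformations are all assembled this way.\<close>

lemma subfunctor_ex:
  assumes G [simp]: "is_functor C D G"
    and monic: "\<And>X. X \<in> Obj C \<Longrightarrow> monic D (k X)"
    and cod: "\<And>X. X \<in> Obj C \<Longrightarrow> Cod D (k X) = FObj G X"
    and fac: "\<And>f. f \<in> Arr C \<Longrightarrow> factors_through D (FArr G f \<cdot>\<^bsub>D\<^esub> k (Dom C f)) (k (Cod C f))"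
  obtains \<kappa> where "is_ntrans C D \<kappa>" "NCod \<kappa> = G" "\<And>X. X \<in> Obj C \<Longrightarrow> NMap \<kappa> X = k X"
proof -
  have k [simp]: "k X \<in> Arr D" "Cod D (k X) = FObj G X" if "X \<in> Obj C" for X
    using monic[OF that] cod[OF that] D.monic_arr by auto
  have "\<exists>h. h \<in> Arr D \<and> Dom D h = Dom D (k (Dom C f)) \<and> Cod D h = Dom D (k (Cod C f)) \<and>
      k (Cod C f) \<cdot>\<^bsub>D\<^esub> h = FArr G f \<cdot>\<^bsub>D\<^esub> k (Dom C f)" if f: "f \<in> Arr C" for f
    using fac[OF f] by (rule D.factors_through_compE) (use f in auto)
  then obtain h where "\<And>f. f \<in> Arr C \<Longrightarrow> h f \<in> Arr D \<and> Dom D (h f) = Dom D (k (Dom C f)) \<and>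
      Cod D (h f) = Dom D (k (Cod C f)) \<and> k (Cod C f) \<cdot>\<^bsub>D\<^esub> h f = FArr G f \<cdot>\<^bsub>D\<^esub> k (Dom C f)"
    by metis
  then have h [simp]: "h f \<in> Arr D" "Dom D (h f) = Dom D (k (Dom C f))"
      "Cod D (h f) = Dom D (k (Cod C f))"
    and kh: "k (Cod C f) \<cdot>\<^bsub>D\<^esub> h f = FArr G f \<cdot>\<^bsub>D\<^esub> k (Dom C f)" if "f \<in> Arr C" for f
    using that by blast+
  have h_id: "h (Ident C X) = Ident D (Dom D (k X))" if X [simp]: "X \<in> Obj C" for X
    using kh[of "Ident C X"] by - (rule D.monic_cancel[OF monic[OF X]], simp_all)
  have h_comp: "h (g \<cdot>\<^bsub>C\<^esub> f) = h g \<cdot>\<^bsub>D\<^esub> h f"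
    if [simp]: "f \<in> Arr C" "g \<in> Arr C" and fg: "Cod C f = Dom C g" for f g
  proof -
    have "k (Cod C g) \<cdot>\<^bsub>D\<^esub> h (g \<cdot>\<^bsub>C\<^esub> f) = FArr G g \<cdot>\<^bsub>D\<^esub> (FArr G f \<cdot>\<^bsub>D\<^esub> k (Dom C f))"
      using kh[of "g \<cdot>\<^bsub>C\<^esub> f"] fg by (simp add: functor_comp D.comp_assoc)
    also have "\<dots> = FArr G g \<cdot>\<^bsub>D\<^esub> (k (Dom C g) \<cdot>\<^bsub>D\<^esub> h f)" using kh[of f] fg by simp
    also have "\<dots> = (FArr G g \<cdot>\<^bsub>D\<^esub> k (Dom C g)) \<cdot>\<^bsub>D\<^esub> h f" using fg by (simp add: D.comp_assoc)
    also have "\<dots> = k (Cod C g) \<cdot>\<^bsub>D\<^esub> (h g \<cdot>\<^bsub>D\<^esub> h f)"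
      using fg by (simp add: D.comp_assoc flip: kh)
    finally show ?thesis
      by (rule D.monic_cancel[OF monic, rotated]) (use fg in auto)
  qed
  define K where "K = \<lparr>FObj = restrict (\<lambda>X. Dom D (k X)) (Obj C), FArr = restrict h (Arr C)\<rparr>"
  have K: "is_functor C D K"
    unfolding is_functor_def Hom_def by (auto simp: K_def h_id h_comp)
  show thesis
  proof (rule that)
    show "is_ntrans C D \<lparr>NDom = K, NCod = G, NMap = restrict k (Obj C)\<rparr>"
      using K by (intro ntransI) (auto simp: Hom_iff K_def kh)
  qed auto
qed

end

section \<open>Pointwise constructions with values in an abelian category\<close>

locale abelian_functor_cat = functor_cat C D + D: abelian D
  for C :: "('a, 'b) cat" and D :: "('o, 'm) cat"
begin

lemma zero_functor:
  assumes Z: "zero_object D Z"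
  shows "zero_object (functor_category C D)
    \<lparr>FObj = (\<lambda>X\<in>Obj C. Z), FArr = (\<lambda>f\<in>Arr C. Ident D Z)\<rparr>" (is "zero_object _ ?Z")
proof -
  have [simp]: "Z \<in> Obj D" using Z by (simp add: zero_object_def)
  have F: "is_functor C D ?Z" unfolding is_functor_def Hom_def by auto
  have "\<exists>!\<eta>. \<eta> \<in> Hom (functor_category C D) F ?Z" "\<exists>!\<eta>. \<eta> \<in> Hom (functor_category C D) ?Z F"
    if G [simp]: "is_functor C D F" for F
  proof -
    have "\<forall>X\<in>Obj C. \<exists>f g. f \<in> Arr D \<and> Dom D f = FObj F X \<and> Cod D f = Z \<and>
        g \<in> Arr D \<and> Dom D g = Z \<and> Cod D g = FObj F X"
      by (meson D.zero_objectE[OF Z] functor_simps(1) G)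
    then have "\<exists>p. \<forall>X\<in>Obj C. p X \<in> Arr D \<and> Dom D (p X) = FObj F X \<and> Cod D (p X) = Z"
      "\<exists>i. \<forall>X\<in>Obj C. i X \<in> Arr D \<and> Dom D (i X) = Z \<and> Cod D (i X) = FObj F X"
      by (intro bchoice; blast)+
    then obtain p i where [simp]: "\<And>X. X \<in> Obj C \<Longrightarrow> p X \<in> Arr D"
      "\<And>X. X \<in> Obj C \<Longrightarrow> Dom D (p X) = FObj F X" "\<And>X. X \<in> Obj C \<Longrightarrow> Cod D (p X) = Z"
      "\<And>X. X \<in> Obj C \<Longrightarrow> i X \<in> Arr D" "\<And>X. X \<in> Obj C \<Longrightarrow> Dom D (i X) = Z"
      "\<And>X. X \<in> Obj C \<Longrightarrow> Cod D (i X) = FObj F X"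
      by blast
    let ?p = "\<lparr>NDom = F, NCod = ?Z, NMap = restrict p (Obj C)\<rparr>"
    let ?i = "\<lparr>NDom = ?Z, NCod = F, NMap = restrict i (Obj C)\<rparr>"
    \<comment> \<open>Naturality squares commute since both composites end in a zero object; for
      \<open>?i\<close> below they start in one.\<close>
    have "is_ntrans C D ?p"
      by (rule ntransI) (auto simp: F Hom_iff intro!: D.zero_object_unique[OF Z])
    moreover have "\<eta> = \<theta>" if "is_ntrans C D \<eta>" "is_ntrans C D \<theta>" "NDom \<eta> = F" "NDom \<theta> = F"
        "NCod \<eta> = ?Z" "NCod \<theta> = ?Z" for \<eta> \<theta>
      by (rule ntrans_eqI) (use that in \<open>auto intro!: D.zero_object_unique[OF Z]\<close>)
    ultimately show "\<exists>!\<eta>. \<eta> \<in> Hom (functor_category C D) F ?Z"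
      unfolding Hom_iff by (intro ex1I[of _ ?p]) auto
    have "is_ntrans C D ?i"
      by (rule ntransI) (auto simp: F Hom_iff intro!: D.zero_object_unique[OF Z])
    moreover have "\<eta> = \<theta>" if "is_ntrans C D \<eta>" "is_ntrans C D \<theta>" "NCod \<eta> = F" "NCod \<theta> = F"
        "NDom \<eta> = ?Z" "NDom \<theta> = ?Z" for \<eta> \<theta>
      by (rule ntrans_eqI) (use that in \<open>auto intro!: D.zero_object_unique[OF Z]\<close>)
    ultimately show "\<exists>!\<eta>. \<eta> \<in> Hom (functor_category C D) ?Z F"
      unfolding Hom_iff by (intro ex1I[of _ ?i]) auto
  qed
  then show ?thesis using F by (simp add: zero_object_def)
qed

text \<open>A zero transformation passes through the constant functor at \<open>Z\<close>, so its
  components pass through \<open>Z\<close>. Conversely, zero components agree with those of the zero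
  transformation between the same functors.\<close>

lemma zero_ntrans_iff:
  "zero_arrow (functor_category C D) \<eta> \<longleftrightarrow>
    is_ntrans C D \<eta> \<and> (\<forall>X\<in>Obj C. zero_arrow D (NMap \<eta> X))"
proof -
  obtain Z where Z: "zero_object D Z" by (rule D.zero_object_ex)
  let ?Z = "\<lparr>FObj = (\<lambda>X\<in>Obj C. Z), FArr = (\<lambda>f\<in>Arr C. Ident D Z)\<rparr>"
  note FZ = zero_functor[OF Z]
  \<comment> \<open>This is stated for every \<eta> because the converse applies it to the
    comparison transformation \<theta>.\<close>
  have pointwise: "zero_arrow D (NMap \<eta> X)"
    if z: "zero_arrow (functor_category C D) \<eta>" and X: "X \<in> Obj C" for \<eta> X
  proof -
    obtain g h where gh: "is_ntrans C D g" "is_ntrans C D h" "NCod g = ?Z" "NDom h = ?Z"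
      and \<eta>: "h \<cdot>\<^bsub>functor_category C D\<^esub> g = \<eta>"
      using z FZ by (rule FC.zero_arrowE) simp
    have "NMap \<eta> X = NMap h X \<cdot>\<^bsub>D\<^esub> NMap g X" using \<eta> X by (rule NMap_comp)
    then show ?thesis using D.zero_arrowI[OF Z, of "NMap g X" "NMap h X"] gh X by simp
  qed
  show ?thesis
  proof (intro iffI conjI ballI)
    assume "zero_arrow (functor_category C D) \<eta>"
    then show "is_ntrans C D \<eta>" using FC.zero_arrow_arr by simp
  next
    assume \<eta>: "is_ntrans C D \<eta> \<and> (\<forall>X\<in>Obj C. zero_arrow D (NMap \<eta> X))"
    obtain \<theta> where \<theta>: "zero_arrow (functor_category C D) \<theta>" "NDom \<theta> = NDom \<eta>" "NCod \<theta> = NCod \<eta>"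
      using FC.zero_arrow_ex[OF FZ, of "NDom \<eta>" "NCod \<eta>"] \<eta> by auto
    have "\<eta> = \<theta>"
    proof (rule ntrans_eqI)
      fix X assume X: "X \<in> Obj C"
      show "NMap \<eta> X = NMap \<theta> X"
        by (rule D.zero_arrow_unique)
          (use \<eta> \<theta> X pointwise[OF \<theta>(1) X] FC.zero_arrow_arr[OF \<theta>(1)] in auto)
    qed (use \<eta> \<theta> FC.zero_arrow_arr[OF \<theta>(1)] in auto)
    then show "zero_arrow (functor_category C D) \<eta>" using \<theta>(1) by simp
  qed (rule pointwise)
qed

text \<open>The pointwise kernel of a monic \<open>\<eta>\<close> is a transformation annihilated by \<open>\<eta>\<close>, hence zero.\<close>

lemma monic_ntrans_iff:
  "monic (functor_category C D) \<eta> \<longleftrightarrow>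
    is_ntrans C D \<eta> \<and> (\<forall>X\<in>Obj C. monic D (NMap \<eta> X))"
proof
  assume m: "monic (functor_category C D) \<eta>"
  then have \<eta> [simp]: "is_ntrans C D \<eta>" using FC.monic_arr by force
  have "\<exists>k. \<forall>X\<in>Obj C. is_kernel D (NMap \<eta> X) (k X)"
    by (rule bchoice) (meson D.kernel_ex ntrans_simps(1) \<eta>)
  then obtain k where k: "\<And>X. X \<in> Obj C \<Longrightarrow> is_kernel D (NMap \<eta> X) (k X)" by auto
  note ker = D.kernel_factors[OF k]
  have k' [simp]: "k X \<in> Arr D" "Cod D (k X) = FObj (NDom \<eta>) X" if "X \<in> Obj C" for X
    using ker(1,2)[OF that] that D.monic_arr by auto
  have zk: "zero_arrow D (NMap \<eta> X \<cdot>\<^bsub>D\<^esub> k X)" if "X \<in> Obj C" for X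
    using k[OF that] by (simp add: is_kernel_def)
  obtain \<kappa> where \<kappa> [simp]: "is_ntrans C D \<kappa>" "NCod \<kappa> = NDom \<eta>"
    and \<kappa>k: "\<And>X. X \<in> Obj C \<Longrightarrow> NMap \<kappa> X = k X"
  proof (rule subfunctor_ex[of "NDom \<eta>" k])
    fix f assume f [simp]: "f \<in> Arr C"
    let ?X = "Dom C f" and ?Y = "Cod C f"
    have "zero_arrow D (FArr (NCod \<eta>) f \<cdot>\<^bsub>D\<^esub> (NMap \<eta> ?X \<cdot>\<^bsub>D\<^esub> k ?X))"
      by (rule D.zero_comp[OF zk]) auto
    also have "FArr (NCod \<eta>) f \<cdot>\<^bsub>D\<^esub> (NMap \<eta> ?X \<cdot>\<^bsub>D\<^esub> k ?X) =
        (FArr (NCod \<eta>) f \<cdot>\<^bsub>D\<^esub> NMap \<eta> ?X) \<cdot>\<^bsub>D\<^esub> k ?X"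
      by (simp add: D.comp_assoc)
    also have "\<dots> = NMap \<eta> ?Y \<cdot>\<^bsub>D\<^esub> (FArr (NDom \<eta>) f \<cdot>\<^bsub>D\<^esub> k ?X)"
      by (simp add: D.comp_assoc flip: ntrans_natural)
    finally show "factors_through D (FArr (NDom \<eta>) f \<cdot>\<^bsub>D\<^esub> k ?X) (k ?Y)"
      by (subst ker(3)) auto
  qed (use ker in auto)
  obtain Z where "zero_object D Z" by (rule D.zero_object_ex)
  then obtain \<zeta> where \<zeta>: "zero_arrow (functor_category C D) \<zeta>" "NDom \<zeta> = NDom \<kappa>" "NCod \<zeta> = NDom \<eta>"
    using FC.zero_arrow_ex[OF zero_functor, of Z "NDom \<kappa>" "NDom \<eta>"] by auto
  have \<zeta>' [simp]: "is_ntrans C D \<zeta>" using \<zeta> FC.zero_arrow_arr by force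
  have "zero_arrow (functor_category C D) (\<eta> \<cdot>\<^bsub>functor_category C D\<^esub> \<kappa>)"
    unfolding zero_ntrans_iff by (simp add: \<kappa>k zk ntrans_comp)
  moreover have "zero_arrow (functor_category C D) (\<eta> \<cdot>\<^bsub>functor_category C D\<^esub> \<zeta>)"
    using \<zeta> by (intro FC.zero_comp) auto
  ultimately have "\<eta> \<cdot>\<^bsub>functor_category C D\<^esub> \<kappa> = \<eta> \<cdot>\<^bsub>functor_category C D\<^esub> \<zeta>"
    by (rule FC.zero_arrow_unique) (simp_all add: \<zeta>)
  then have "\<kappa> = \<zeta>" by (rule FC.monic_cancel[OF m]) (simp_all add: \<zeta>)
  then have kz: "zero_arrow D (k X)" if "X \<in> Obj C" for X
    using \<zeta>(1) that \<kappa>k[OF that] by (auto simp: zero_ntrans_iff)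
  have "monic D (NMap \<eta> X)" if X: "X \<in> Obj C" for X
  proof (rule D.monicI_zero)
    fix f assume "f \<in> Arr D" "Cod D f = Dom D (NMap \<eta> X)" "zero_arrow D (NMap \<eta> X \<cdot>\<^bsub>D\<^esub> f)"
    then have "factors_through D f (k X)" using ker(3)[OF X] by simp
    then show "zero_arrow D f"
      using kz[OF X] D.comp_zero by (auto elim!: D.factors_throughE)
  qed (simp add: X)
  then show "is_ntrans C D \<eta> \<and> (\<forall>X\<in>Obj C. monic D (NMap \<eta> X))" by simp
qed (use monicI_pointwise in auto)

text \<open>Factorization of transformations reduces to components, because a monic \<theta> has
  monic components.\<close>

lemma factors_through_monic_iff:
  assumes "is_ntrans C D \<eta>" "monic (functor_category C D) \<theta>" "NCod \<eta> = NCod \<theta>"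
  shows "factors_through (functor_category C D) \<eta> \<theta> \<longleftrightarrow>
    (\<forall>X\<in>Obj C. factors_through D (NMap \<eta> X) (NMap \<theta> X))"
  using assms factors_through_pointwise factors_throughI_pointwise
  by (auto simp: monic_ntrans_iff)

text \<open>Preimages are taken objectwise. An arrow of \<open>NDom g\<close> preserves them because
  naturality of \<open>g\<close> and then of \<open>f\<close> carries a factor \<open>v\<close> at
  the source to one at the target.\<close>

lemma ntrans_pullback_ex:
  assumes f: "monic (functor_category C D) f" and g [simp]: "is_ntrans C D g"
    and cod [simp]: "NCod f = NCod g"
  obtains p p' where "is_pullback (functor_category C D) f g p p'"
proof -
  have f' [simp]: "is_ntrans C D f" and fm: "\<And>X. X \<in> Obj C \<Longrightarrow> monic D (NMap f X)"
    using f by (auto simp: monic_ntrans_iff)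
  have "\<exists>p p'. is_pullback D (NMap f X) (NMap g X) p p'" if X: "X \<in> Obj C" for X
  proof -
    obtain p p' where "is_pullback D (NMap f X) (NMap g X) p p'"
      by (rule D.monic_pullback_ex[OF fm[OF X], of "NMap g X"]) (use X in auto)
    then show ?thesis by blast
  qed
  then obtain p where pb: "\<And>X. X \<in> Obj C \<Longrightarrow> \<exists>p'. is_pullback D (NMap f X) (NMap g X) (p X) p'"
    by metis
  have p: "monic D (p X)" "Cod D (p X) = FObj (NDom g) X"
    "\<And>u. \<lbrakk>u \<in> Arr D; Cod D u = FObj (NDom g) X\<rbrakk> \<Longrightarrow>
      factors_through D u (p X) \<longleftrightarrow> factors_through D (NMap g X \<cdot>\<^bsub>D\<^esub> u) (NMap f X)"
    if "X \<in> Obj C" for X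
    using pb[OF that] D.monic_pullback_iff[OF fm[OF that], of "NMap g X" "p X"] that by auto
  have p' [simp]: "p X \<in> Arr D" "Cod D (p X) = FObj (NDom g) X" if "X \<in> Obj C" for X
    using p[OF that] D.monic_arr by auto
  obtain \<pi> where \<pi> [simp]: "is_ntrans C D \<pi>" "NCod \<pi> = NDom g"
    and \<pi>p: "\<And>X. X \<in> Obj C \<Longrightarrow> NMap \<pi> X = p X"
  proof (rule subfunctor_ex[of "NDom g" p])
    fix h assume h [simp]: "h \<in> Arr C"
    let ?X = "Dom C h" and ?Y = "Cod C h"
    have "factors_through D (NMap g ?X \<cdot>\<^bsub>D\<^esub> p ?X) (NMap f ?X)"
      using p(3)[of ?X "p ?X"] D.factors_through_refl[of "p ?X"] by simp
    then obtain v where v [simp]: "v \<in> Arr D" "Dom D v = Dom D (p ?X)" "Cod D v = FObj (NDom f) ?X"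
      and fv: "NMap f ?X \<cdot>\<^bsub>D\<^esub> v = NMap g ?X \<cdot>\<^bsub>D\<^esub> p ?X"
      by (rule D.factors_through_compE) auto
    have "NMap g ?Y \<cdot>\<^bsub>D\<^esub> (FArr (NDom g) h \<cdot>\<^bsub>D\<^esub> p ?X) = (NMap g ?Y \<cdot>\<^bsub>D\<^esub> FArr (NDom g) h) \<cdot>\<^bsub>D\<^esub> p ?X"
      by (simp add: D.comp_assoc)
    also have "\<dots> = FArr (NCod g) h \<cdot>\<^bsub>D\<^esub> (NMap f ?X \<cdot>\<^bsub>D\<^esub> v)"
      by (simp add: ntrans_natural D.comp_assoc fv)
    also have "\<dots> = (FArr (NCod f) h \<cdot>\<^bsub>D\<^esub> NMap f ?X) \<cdot>\<^bsub>D\<^esub> v"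
      by (simp add: D.comp_assoc)
    also have "\<dots> = NMap f ?Y \<cdot>\<^bsub>D\<^esub> (FArr (NDom f) h \<cdot>\<^bsub>D\<^esub> v)"
      by (simp add: D.comp_assoc flip: ntrans_natural cod)
    finally have "factors_through D (NMap g ?Y \<cdot>\<^bsub>D\<^esub> (FArr (NDom g) h \<cdot>\<^bsub>D\<^esub> p ?X)) (NMap f ?Y)"
      by (rule D.factors_throughI[rotated 3]) auto
    then show "factors_through D (FArr (NDom g) h \<cdot>\<^bsub>D\<^esub> p ?X) (p ?Y)"
      by (subst p(3)) auto
  qed (use p in auto)
  have \<pi>m: "monic (functor_category C D) \<pi>" by (simp add: monic_ntrans_iff \<pi>p p)
  have "factors_through (functor_category C D) u \<pi> \<longleftrightarrow>
      factors_through (functor_category C D) (g \<cdot>\<^bsub>functor_category C D\<^esub> u) f"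
    if "is_ntrans C D u" "NCod u = NDom g" for u
    using that ntrans_comp[of u g] by (simp add: factors_through_monic_iff \<pi>m f \<pi>p p(3))
  then show thesis
    using that \<pi>m FC.monic_pullback_iff[OF f, of g \<pi>] by auto
qed

text \<open>No bound on \<open>M\<close> is required: at each object only subobjects of
  \<open>FObj G X\<close> are intersected, and these form a small set. Factorization through the
  result is then read off from components.\<close>

lemma ntrans_intersection_ex:
  assumes complete: "complete_category TYPE('u) D" and small: "locally_small TYPE('u) D"
    and G [simp]: "is_functor C D G" and M: "M \<subseteq> monos_into (functor_category C D) G"
  obtains \<kappa> where "intersection (functor_category C D) G M \<kappa>"
proof -
  have m [simp]: "is_ntrans C D m" "NCod m = G" "\<And>X. X \<in> Obj C \<Longrightarrow> monic D (NMap m X)"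
    and mm: "monic (functor_category C D) m" if "m \<in> M" for m
    using M that by (auto simp: FC.monos_into_iff monic_ntrans_iff)
  have "\<exists>k. intersection D (FObj G X) ((\<lambda>m. NMap m X) ` M) k" if X: "X \<in> Obj C" for X
  proof -
    have "(\<lambda>m. NMap m X) ` M \<subseteq> monos_into D (FObj G X)"
      using X by (auto simp: D.monos_into_iff)
    then obtain k where "intersection D (FObj G X) ((\<lambda>m. NMap m X) ` M) k"
      by (rule D.intersection_ex[OF complete small functor_simps(1)[OF G X]])
    then show ?thesis ..
  qed
  then obtain k where k: "\<And>X. X \<in> Obj C \<Longrightarrow> intersection D (FObj G X) ((\<lambda>m. NMap m X) ` M) (k X)"
    by metis
  have k' [simp]: "k X \<in> Arr D" "Cod D (k X) = FObj G X" and km: "monic D (k X)"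
    if "X \<in> Obj C" for X
    using k[OF that] by (auto simp: intersection_def D.monos_into_iff D.monic_arr)
  have k_iff: "factors_through D f (k X) \<longleftrightarrow> (\<forall>m\<in>M. factors_through D f (NMap m X))"
    if "X \<in> Obj C" "f \<in> Arr D" "Cod D f = FObj G X" for f X
    using k[OF that(1)] that by (simp add: intersection_def)
  obtain \<kappa> where \<kappa> [simp]: "is_ntrans C D \<kappa>" "NCod \<kappa> = G"
    and \<kappa>k: "\<And>X. X \<in> Obj C \<Longrightarrow> NMap \<kappa> X = k X"
  proof (rule subfunctor_ex[of G k])
    fix f assume f [simp]: "f \<in> Arr C"
    let ?X = "Dom C f" and ?Y = "Cod C f"
    \<comment> \<open>Each \<open>m\<close> is a subfunctor of \<open>G\<close>, so what lies in
      \<open>m\<close> at \<open>?X\<close> is carried into \<open>m\<close> at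
      \<open>?Y\<close>.\<close>
    have "factors_through D (FArr G f \<cdot>\<^bsub>D\<^esub> k ?X) (NMap m ?Y)" if M: "m \<in> M" for m
    proof -
      note [simp] = m[OF M]
      have "factors_through D (k ?X) (NMap m ?X)"
        using k_iff[of ?X "k ?X"] D.factors_through_refl[of "k ?X"] M by simp
      then obtain v where v [simp]: "v \<in> Arr D" "Dom D v = Dom D (k ?X)"
          "Cod D v = Dom D (NMap m ?X)" and mv: "NMap m ?X \<cdot>\<^bsub>D\<^esub> v = k ?X"
        by (rule D.factors_throughE)
      have "FArr G f \<cdot>\<^bsub>D\<^esub> k ?X = (FArr (NCod m) f \<cdot>\<^bsub>D\<^esub> NMap m ?X) \<cdot>\<^bsub>D\<^esub> v"
        by (simp add: D.comp_assoc mv)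
      also have "\<dots> = (NMap m ?Y \<cdot>\<^bsub>D\<^esub> FArr (NDom m) f) \<cdot>\<^bsub>D\<^esub> v"
        by (simp only: ntrans_natural[OF m(1)[OF M] f])
      also have "\<dots> = NMap m ?Y \<cdot>\<^bsub>D\<^esub> (FArr (NDom m) f \<cdot>\<^bsub>D\<^esub> v)"
        by (simp add: D.comp_assoc)
      finally show ?thesis by (rule D.factors_throughI[rotated 3]) auto
    qed
    then show "factors_through D (FArr G f \<cdot>\<^bsub>D\<^esub> k ?X) (k ?Y)"
      by (subst k_iff) auto
  qed (use km in auto)
  have \<kappa>m: "monic (functor_category C D) \<kappa>" by (simp add: monic_ntrans_iff \<kappa>k km)
  have "factors_through (functor_category C D) f \<kappa> \<longleftrightarrow>
      (\<forall>m\<in>M. factors_through (functor_category C D) f m)"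
    if "is_ntrans C D f" "NCod f = G" for f
    using that by (auto simp: factors_through_monic_iff \<kappa>m mm \<kappa>k k_iff)
  then have "intersection (functor_category C D) G M \<kappa>"
    using \<kappa>m by (simp add: intersection_def FC.monos_into_iff)
  then show thesis by (rule that)
qed

text \<open>Cokernels are chosen objectwise. As the \<open>q X\<close> can be cancelled on the
  right, the induced arrows between quotients are unique; hence the quotient is a functor and
  mediating arrows are natural.\<close>

lemma ntrans_cokernel_ex:
  assumes s [simp]: "is_ntrans C D s"
  obtains q where "is_cokernel (functor_category C D) s q"
proof -
  have "\<exists>q. \<forall>X\<in>Obj C. is_cokernel D (NMap s X) (q X)"
    by (rule bchoice) (meson D.cokernel_ex ntrans_simps(1) s)
  then obtain q where q: "\<And>X. X \<in> Obj C \<Longrightarrow> is_cokernel D (NMap s X) (q X)" by auto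
  note cancel = D.cokernel_cancel[OF q]
  have q' [simp]: "q X \<in> Arr D" "Dom D (q X) = FObj (NCod s) X" if "X \<in> Obj C" for X
    using D.cokernel_arr[OF q[OF that]] that by auto
  have zq: "zero_arrow D (q X \<cdot>\<^bsub>D\<^esub> NMap s X)" if "X \<in> Obj C" for X
    using D.cokernel_arr[OF q[OF that]] by auto
  let ?G = "NCod s"
  have "\<exists>h. h \<in> Arr D \<and> Dom D h = Cod D (q (Dom C f)) \<and> Cod D h = Cod D (q (Cod C f)) \<and>
      h \<cdot>\<^bsub>D\<^esub> q (Dom C f) = q (Cod C f) \<cdot>\<^bsub>D\<^esub> FArr ?G f" if f [simp]: "f \<in> Arr C" for f
  proof -
    let ?X = "Dom C f" and ?Y = "Cod C f"
    \<comment> \<open>By naturality of \<open>s\<close>, the arrow \<open>FArr ?G f\<close> followed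
      by \<open>q ?Y\<close> kills \<open>NMap s ?X\<close>, so it descends to the quotient at
      \<open>?X\<close>.\<close>
    have "zero_arrow D ((q ?Y \<cdot>\<^bsub>D\<^esub> NMap s ?Y) \<cdot>\<^bsub>D\<^esub> FArr (NDom s) f)"
      by (rule D.comp_zero[OF zq]) auto
    also have "(q ?Y \<cdot>\<^bsub>D\<^esub> NMap s ?Y) \<cdot>\<^bsub>D\<^esub> FArr (NDom s) f =
        (q ?Y \<cdot>\<^bsub>D\<^esub> FArr ?G f) \<cdot>\<^bsub>D\<^esub> NMap s ?X"
      by (simp add: D.comp_assoc ntrans_natural)
    finally obtain h where "h \<in> Arr D" "Dom D h = Cod D (q ?X)"
        "Cod D h = Cod D (q ?Y \<cdot>\<^bsub>D\<^esub> FArr ?G f)" "h \<cdot>\<^bsub>D\<^esub> q ?X = q ?Y \<cdot>\<^bsub>D\<^esub> FArr ?G f"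
      by (rule D.cokernel_factor[OF q, rotated 3]) auto
    then show ?thesis by auto
  qed
  then obtain h where "\<And>f. f \<in> Arr C \<Longrightarrow> h f \<in> Arr D \<and> Dom D (h f) = Cod D (q (Dom C f)) \<and>
      Cod D (h f) = Cod D (q (Cod C f)) \<and> h f \<cdot>\<^bsub>D\<^esub> q (Dom C f) = q (Cod C f) \<cdot>\<^bsub>D\<^esub> FArr ?G f"
    by metis
  then have h [simp]: "h f \<in> Arr D" "Dom D (h f) = Cod D (q (Dom C f))"
      "Cod D (h f) = Cod D (q (Cod C f))"
    and hq: "h f \<cdot>\<^bsub>D\<^esub> q (Dom C f) = q (Cod C f) \<cdot>\<^bsub>D\<^esub> FArr ?G f" if "f \<in> Arr C" for f
    using that by blast+
  have h_id: "h (Ident C X) = Ident D (Cod D (q X))" if X [simp]: "X \<in> Obj C" for X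
    using hq[of "Ident C X"] by - (rule cancel[OF X], simp_all)
  have h_comp: "h (g \<cdot>\<^bsub>C\<^esub> f) = h g \<cdot>\<^bsub>D\<^esub> h f"
    if [simp]: "f \<in> Arr C" "g \<in> Arr C" and fg: "Cod C f = Dom C g" for f g
  proof -
    have "h (g \<cdot>\<^bsub>C\<^esub> f) \<cdot>\<^bsub>D\<^esub> q (Dom C f) = (q (Cod C g) \<cdot>\<^bsub>D\<^esub> FArr ?G g) \<cdot>\<^bsub>D\<^esub> FArr ?G f"
      using hq[of "g \<cdot>\<^bsub>C\<^esub> f"] fg by (simp add: functor_comp D.comp_assoc)
    also have "\<dots> = h g \<cdot>\<^bsub>D\<^esub> (q (Cod C f) \<cdot>\<^bsub>D\<^esub> FArr ?G f)"
      using fg by (simp add: D.comp_assoc flip: hq)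
    also have "\<dots> = (h g \<cdot>\<^bsub>D\<^esub> h f) \<cdot>\<^bsub>D\<^esub> q (Dom C f)"
      using fg hq[of f] by (simp add: D.comp_assoc)
    finally show ?thesis
      by (rule cancel[rotated]) (use fg in auto)
  qed
  define Q where "Q = \<lparr>FObj = restrict (\<lambda>X. Cod D (q X)) (Obj C), FArr = restrict h (Arr C)\<rparr>"
  have Q: "is_functor C D Q"
    unfolding is_functor_def Hom_def by (auto simp: Q_def h_id h_comp)
  define \<chi> where "\<chi> = \<lparr>NDom = ?G, NCod = Q, NMap = restrict q (Obj C)\<rparr>"
  have \<chi>: "is_ntrans C D \<chi>"
    using Q by (intro ntransI) (auto simp: Hom_iff Q_def \<chi>_def hq)
  have [simp]: "NMap \<chi> X = q X" "FObj (NCod \<chi>) X = Cod D (q X)" if "X \<in> Obj C" for X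
    using that by (simp_all add: \<chi>_def Q_def)
  have [simp]: "NDom \<chi> = ?G" by (simp add: \<chi>_def)
  have univ: "\<exists>!h. h \<in> Hom (functor_category C D) (NCod \<chi>) (NCod g) \<and>
      h \<cdot>\<^bsub>functor_category C D\<^esub> \<chi> = g"
    if g [simp]: "is_ntrans C D g" and gd [simp]: "NDom g = ?G"
      and z: "zero_arrow (functor_category C D) (g \<cdot>\<^bsub>functor_category C D\<^esub> s)" for g
  proof -
    have "\<exists>w. w \<in> Arr D \<and> Dom D w = Cod D (q X) \<and> Cod D w = FObj (NCod g) X \<and>
        w \<cdot>\<^bsub>D\<^esub> q X = NMap g X" if X: "X \<in> Obj C" for X
    proof -
      have "zero_arrow D (NMap g X \<cdot>\<^bsub>D\<^esub> NMap s X)" using z X by (simp add: zero_ntrans_iff)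
      then obtain w where "w \<in> Arr D" "Dom D w = Cod D (q X)" "Cod D w = Cod D (NMap g X)"
          "w \<cdot>\<^bsub>D\<^esub> q X = NMap g X"
        by (rule D.cokernel_factor[OF q, rotated 3]) (use X in auto)
      then show ?thesis using X by auto
    qed
    then obtain w where "\<And>X. X \<in> Obj C \<Longrightarrow> w X \<in> Arr D \<and> Dom D (w X) = Cod D (q X) \<and>
        Cod D (w X) = FObj (NCod g) X \<and> w X \<cdot>\<^bsub>D\<^esub> q X = NMap g X"
      by metis
    then have w [simp]: "w X \<in> Arr D" "Dom D (w X) = Cod D (q X)"
      "Cod D (w X) = FObj (NCod g) X" and wq: "w X \<cdot>\<^bsub>D\<^esub> q X = NMap g X" if "X \<in> Obj C" for X
      using that by blast+
    let ?w = "\<lparr>NDom = NCod \<chi>, NCod = NCod g, NMap = restrict w (Obj C)\<rparr>"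
    have nt: "is_ntrans C D ?w"
    proof (rule ntransI)
      fix f assume f [simp]: "f \<in> Arr C"
      let ?X = "Dom C f" and ?Y = "Cod C f"
      have "(w ?Y \<cdot>\<^bsub>D\<^esub> h f) \<cdot>\<^bsub>D\<^esub> q ?X = (w ?Y \<cdot>\<^bsub>D\<^esub> q ?Y) \<cdot>\<^bsub>D\<^esub> FArr ?G f"
        by (simp add: D.comp_assoc hq)
      also have "\<dots> = FArr (NCod g) f \<cdot>\<^bsub>D\<^esub> NMap g ?X"
        using ntrans_natural[OF g f] by (simp add: wq)
      also have "\<dots> = (FArr (NCod g) f \<cdot>\<^bsub>D\<^esub> w ?X) \<cdot>\<^bsub>D\<^esub> q ?X"
        by (simp add: D.comp_assoc wq)
      finally have "w ?Y \<cdot>\<^bsub>D\<^esub> h f = FArr (NCod g) f \<cdot>\<^bsub>D\<^esub> w ?X"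
        by (rule cancel[rotated]) auto
      then show "NMap ?w ?Y \<cdot>\<^bsub>D\<^esub> FArr (NDom ?w) f = FArr (NCod ?w) f \<cdot>\<^bsub>D\<^esub> NMap ?w ?X"
        by (simp add: \<chi>_def Q_def)
    qed (use \<chi> in \<open>auto simp: Hom_iff\<close>)
    show ?thesis
    proof (rule ex1I[of _ ?w])
      have "?w \<cdot>\<^bsub>functor_category C D\<^esub> \<chi> = g"
        by (rule ntrans_eqI) (use nt \<chi> ntrans_comp[OF \<chi> nt] in \<open>auto simp: wq\<close>)
      then show "?w \<in> Hom (functor_category C D) (NCod \<chi>) (NCod g) \<and>
          ?w \<cdot>\<^bsub>functor_category C D\<^esub> \<chi> = g"
        using nt by (simp add: Hom_iff)
    next
      fix v assume "v \<in> Hom (functor_category C D) (NCod \<chi>) (NCod g) \<and>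
          v \<cdot>\<^bsub>functor_category C D\<^esub> \<chi> = g"
      then have v: "is_ntrans C D v" "NDom v = NCod \<chi>" "NCod v = NCod g"
        and vg: "v \<cdot>\<^bsub>functor_category C D\<^esub> \<chi> = g"
        by (auto simp: Hom_iff)
      show "v = ?w"
      proof (rule ntrans_eqI[OF v(1) nt])
        fix X assume X: "X \<in> Obj C"
        have "NMap v X \<cdot>\<^bsub>D\<^esub> q X = w X \<cdot>\<^bsub>D\<^esub> q X"
          using NMap_comp[OF vg X] wq[OF X] X by simp
        with X have "NMap v X = w X"
          by (rule cancel) (use v X in simp_all)
        then show "NMap v X = NMap ?w X" using X by simp
      qed (use v in simp_all)
    qed
  qed
  have "zero_arrow (functor_category C D) (\<chi> \<cdot>\<^bsub>functor_category C D\<^esub> s)"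
    using \<chi> ntrans_comp[OF s \<chi>] by (simp add: zero_ntrans_iff zq)
  then have "is_cokernel (functor_category C D) s \<chi>"
    unfolding is_cokernel_iff using \<chi> univ by simp
  then show thesis by (rule that)
qed

end

section \<open>Preradicals\<close>

context abelian
begin

interpretation F: abelian_functor_cat C C ..

abbreviation "Fun \<equiv> functor_category C C"

section \<open>Identity functor, composite functors and whiskering\<close>

lemma id_functor_simps [simp]:
  "X \<in> Obj C \<Longrightarrow> FObj (id_functor C) X = X"
  "f \<in> Arr C \<Longrightarrow> FArr (id_functor C) f = f"
  by (simp_all add: id_functor_def)

lemma id_functor_functor [simp]: "is_functor C C (id_functor C)"
  unfolding is_functor_def Hom_def by (auto simp: id_functor_def)

lemma comp_functor_functor [simp]:
  assumes "is_functor C C G" "is_functor C C F"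
  shows "is_functor C C (comp_functor C G F)"
  using assms unfolding is_functor_def[of _ _ "comp_functor C G F"] Hom_def
  by (auto simp: comp_functor_def F.functor_comp)

lemma comp_functor_simps [simp]:
  "X \<in> Obj C \<Longrightarrow> FObj (comp_functor C G F) X = FObj G (FObj F X)"
  "f \<in> Arr C \<Longrightarrow> FArr (comp_functor C G F) f = FArr G (FArr F f)"
  by (simp_all add: comp_functor_def)

text \<open>Equality is literal since \<open>G\<close> is extensional. It gives a whiskered
  preradical the codomain \<open>G\<close> itself, so that it can be pulled back along a quotient
  map with codomain \<open>G\<close>.\<close>

lemma comp_id_functor [simp]:
  assumes "is_functor C C G"
  shows "comp_functor C (id_functor C) G = G"
proof -
  have "FObj G \<in> extensional (Obj C)" "FArr G \<in> extensional (Arr C)"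
    using assms unfolding is_functor_def PiE_def by blast+
  then have "FObj (comp_functor C (id_functor C) G) = FObj G"
    "FArr (comp_functor C (id_functor C) G) = FArr G"
    using assms by (auto simp: comp_functor_def extensional_def fun_eq_iff)
  then show ?thesis by simp
qed

lemma whisker_simps [simp]:
  "NDom (whisker C \<eta> G) = comp_functor C (NDom \<eta>) G"
  "NCod (whisker C \<eta> G) = comp_functor C (NCod \<eta>) G"
  "X \<in> Obj C \<Longrightarrow> NMap (whisker C \<eta> G) X = NMap \<eta> (FObj G X)"
  by (simp_all add: whisker_def)

lemma whisker_ntrans [simp]:
  assumes "is_ntrans C C \<eta>" "is_functor C C G"
  shows "is_ntrans C C (whisker C \<eta> G)"
proof (rule F.ntransI)
  fix f assume f: "f \<in> Arr C"
  then show "NMap (whisker C \<eta> G) (Cod C f) \<cdot> FArr (NDom (whisker C \<eta> G)) f =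
      FArr (NCod (whisker C \<eta> G)) f \<cdot> NMap (whisker C \<eta> G) (Dom C f)"
    using F.ntrans_natural[OF assms(1), of "FArr G f"] assms by simp
qed (use assms in \<open>auto simp: Hom_iff whisker_def\<close>)

text \<open>The components of the whiskered transformation are components of \<open>t\<close> at
  other objects, and monic transformations are monic at every object.\<close>

lemma whisker_monic:
  assumes "monic Fun t" "is_functor C C G"
  shows "monic Fun (whisker C t G)"
  using assms by (auto simp: F.monic_ntrans_iff)

section \<open>Representatives of preradicals and their quotients\<close>

lemma Pr_monosD:
  assumes "s \<in> monos_into Fun (id_functor C)"
  shows "monic Fun s" "is_ntrans C C s" "NCod s = id_functor C"
  using assms by (auto simp: F.FC.monos_into_iff F.monic_ntrans_iff)

lemma cokernelD:
  assumes "is_cokernel Fun s q" "NCod s = id_functor C"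
  shows "is_ntrans C C q" "NDom q = id_functor C" "is_functor C C (NCod q)"
    "zero_arrow Fun (q \<cdot>\<^bsub>Fun\<^esub> s)"
  using F.FC.cokernel_arr[OF assms(1)] assms(2) by auto

text \<open>Naturality of \<open>t\<close> at the components of \<open>w : G \<rightarrow> H\<close> turns \<open>w \<cdot> tG\<close> into \<open>tH \<cdot> Tw\<close>.\<close>

lemma comp_whisker_factors:
  assumes t: "t \<in> monos_into Fun (id_functor C)" and s: "s \<in> monos_into Fun (id_functor C)"
    and ts: "factors_through Fun t s"
    and w: "is_ntrans C C w"
  shows "factors_through Fun (w \<cdot>\<^bsub>Fun\<^esub> whisker C t (NDom w)) (whisker C s (NCod w))"
proof -
  note [simp] = w Pr_monosD[OF t] Pr_monosD[OF s]
  have "factors_through C (NMap w X \<cdot> NMap t (FObj (NDom w) X)) (NMap s (FObj (NCod w) X))"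
    if X [simp]: "X \<in> Obj C" for X
  proof -
    have eq: "NMap w X \<cdot> NMap t (FObj (NDom w) X) =
        NMap t (FObj (NCod w) X) \<cdot> FArr (NDom t) (NMap w X)"
      using F.ntrans_natural[of t "NMap w X"] by simp
    have "factors_through C (NMap t (FObj (NCod w) X)) (NMap s (FObj (NCod w) X))"
      using F.factors_through_pointwise[OF ts] by simp
    then show ?thesis unfolding eq by (rule factors_through_comp) auto
  qed
  moreover have "is_ntrans C C (w \<cdot>\<^bsub>Fun\<^esub> whisker C t (NDom w))"
    unfolding functor_category_simps by (rule F.ntrans_comp) auto
  ultimately show ?thesis
    by (subst F.factors_through_monic_iff) (auto simp: whisker_monic)
qed

text \<open>The condition that describes the coproduct weakens as both subobjects grow:
  \<open>q'\<close> is \<open>w\<close> after \<open>q\<close>, and \<open>w\<close> carries the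
  values of \<open>t\<close> on the first quotient into those of \<open>t'\<close> on the second.
  This serves both independence of representatives and the final argument.\<close>

lemma comp_cokernel_factors_mono:
  assumes s: "s \<in> monos_into Fun (id_functor C)" "s' \<in> monos_into Fun (id_functor C)"
    "factors_through Fun s s'"
    and t: "t \<in> monos_into Fun (id_functor C)" "t' \<in> monos_into Fun (id_functor C)"
    "factors_through Fun t t'"
    and q: "is_cokernel Fun s q" "is_cokernel Fun s' q'"
    and u: "is_ntrans C C u" "NCod u = id_functor C"
    and qu: "factors_through Fun (q \<cdot>\<^bsub>Fun\<^esub> u) (whisker C t (NCod q))"
  shows "factors_through Fun (q' \<cdot>\<^bsub>Fun\<^esub> u) (whisker C t' (NCod q'))"
proof -
  note [simp] = Pr_monosD[OF s(1)] Pr_monosD[OF s(2)] Pr_monosD[OF t(1)] Pr_monosD[OF t(2)] u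
  note [simp] = cokernelD[OF q(1)] cokernelD[OF q(2)]
  obtain w where "w \<in> Arr Fun" "Dom Fun w = Cod Fun q" "Cod Fun w = Cod Fun q'"
      and wq: "w \<cdot>\<^bsub>Fun\<^esub> q = q'"
    using F.FC.cokernel_map[OF q s(3)] by auto
  then have w [simp]: "is_ntrans C C w" "NDom w = NCod q" "NCod w = NCod q'" by auto
  have wt: "factors_through Fun (w \<cdot>\<^bsub>Fun\<^esub> whisker C t (NCod q)) (whisker C t' (NCod q'))"
    using comp_whisker_factors[OF t w(1)] by simp
  obtain v where v: "v \<in> Arr Fun" "Dom Fun v = Dom Fun u" "Cod Fun v = Dom Fun (whisker C t (NCod q))"
    and eq: "whisker C t (NCod q) \<cdot>\<^bsub>Fun\<^esub> v = q \<cdot>\<^bsub>Fun\<^esub> u"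
    using qu by (rule F.FC.factors_through_compE) auto
  have "q' \<cdot>\<^bsub>Fun\<^esub> u = w \<cdot>\<^bsub>Fun\<^esub> (q \<cdot>\<^bsub>Fun\<^esub> u)"
    unfolding wq[symmetric] by (rule F.FC.comp_assoc) auto
  also have "\<dots> = (w \<cdot>\<^bsub>Fun\<^esub> whisker C t (NCod q)) \<cdot>\<^bsub>Fun\<^esub> v"
    unfolding eq[symmetric] using v by (intro F.FC.comp_assoc[symmetric]) auto
  finally have eq': "q' \<cdot>\<^bsub>Fun\<^esub> u = (w \<cdot>\<^bsub>Fun\<^esub> whisker C t (NCod q)) \<cdot>\<^bsub>Fun\<^esub> v" .
  show ?thesis unfolding eq' using wt
    by (rule F.FC.factors_through_comp) (use v in auto)
qed

section \<open>Coproducts of preradicals and radicals\<close>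

lemma coproduct_pullback_iff:
  assumes t: "t \<in> monos_into Fun (id_functor C)" and s: "s \<in> monos_into Fun (id_functor C)"
    and q: "is_cokernel Fun s q"
  shows "(\<exists>p'. is_pullback Fun (whisker C t (NCod q)) q p p') \<longleftrightarrow>
    p \<in> monos_into Fun (id_functor C) \<and>
    (\<forall>u. is_ntrans C C u \<and> NCod u = id_functor C \<longrightarrow>
      (factors_through Fun u p \<longleftrightarrow> factors_through Fun (q \<cdot>\<^bsub>Fun\<^esub> u) (whisker C t (NCod q))))"
proof -
  note [simp] = Pr_monosD[OF t] Pr_monosD[OF s]
  note [simp] = cokernelD[OF q]
  show ?thesis
    using F.FC.monic_pullback_iff[of "whisker C t (NCod q)" q p]
    by (auto simp: whisker_monic F.FC.monos_into_iff)
qed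

text \<open>\<open>p\<close> satisfies its own pullback condition, hence the weaker one describing
  \<open>p'\<close>. Applied in both directions to equivalent data, this makes the coproduct
  independent of representatives.\<close>

lemma coproduct_pullback_le:
  assumes s: "s \<in> monos_into Fun (id_functor C)" "s' \<in> monos_into Fun (id_functor C)"
    "factors_through Fun s s'"
    and t: "t \<in> monos_into Fun (id_functor C)" "t' \<in> monos_into Fun (id_functor C)"
    "factors_through Fun t t'"
    and q: "is_cokernel Fun s q" "is_cokernel Fun s' q'"
    and p: "is_pullback Fun (whisker C t (NCod q)) q p v"
      "is_pullback Fun (whisker C t' (NCod q')) q' p' v'"
  shows "factors_through Fun p p'"
proof -
  have p1: "p \<in> monos_into Fun (id_functor C)"
    "\<And>u. is_ntrans C C u \<Longrightarrow> NCod u = id_functor C \<Longrightarrow>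
      factors_through Fun u p \<longleftrightarrow> factors_through Fun (q \<cdot>\<^bsub>Fun\<^esub> u) (whisker C t (NCod q))"
    using coproduct_pullback_iff[OF t(1) s(1) q(1), of p] p(1) by blast+
  note [simp] = Pr_monosD[OF p1(1)]
  have p2: "\<And>u. is_ntrans C C u \<Longrightarrow> NCod u = id_functor C \<Longrightarrow>
      factors_through Fun u p' \<longleftrightarrow> factors_through Fun (q' \<cdot>\<^bsub>Fun\<^esub> u) (whisker C t' (NCod q'))"
    using coproduct_pullback_iff[OF t(2) s(2) q(2), of p'] p(2) by blast
  have "factors_through Fun (q \<cdot>\<^bsub>Fun\<^esub> p) (whisker C t (NCod q))"
    using p1(2)[of p] F.FC.factors_through_refl[of p] by simp
  then have "factors_through Fun (q' \<cdot>\<^bsub>Fun\<^esub> p) (whisker C t' (NCod q'))"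
    by (intro comp_cokernel_factors_mono[OF s t q]) simp_all
  then show ?thesis using p2[of p] by simp
qed

text \<open>The definite description in \<open>coproduct\<close> is meaningful because changing
  representatives, cokernel or pullback changes \<open>p\<close> only up to equivalence.\<close>

lemma coproduct_eq:
  assumes \<sigma>: "\<sigma> \<in> carrier (Pr C)" "s \<in> \<sigma>" and \<tau>: "\<tau> \<in> carrier (Pr C)" "t \<in> \<tau>"
    and q: "is_cokernel Fun s q" and p: "is_pullback Fun (whisker C t (NCod q)) q p p'"
  shows "coproduct C \<sigma> \<tau> = mono_equiv Fun (id_functor C) `` {p}"
  unfolding coproduct_def
proof (rule the_equality)
  note st = F.FC.Sub_carrierD[OF \<sigma>[unfolded Pr_def]] F.FC.Sub_carrierD[OF \<tau>[unfolded Pr_def]]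
  fix \<rho>
  assume "\<exists>s\<in>\<sigma>. \<exists>t\<in>\<tau>. \<exists>q p p'. is_cokernel Fun s q \<and>
    is_pullback Fun (whisker C t (NCod q)) q p p' \<and> \<rho> = mono_equiv Fun (id_functor C) `` {p}"
  then obtain s2 t2 q2 p2 p2' where st2: "s2 \<in> \<sigma>" "t2 \<in> \<tau>"
    and q2: "is_cokernel Fun s2 q2" and p2: "is_pullback Fun (whisker C t2 (NCod q2)) q2 p2 p2'"
    and \<rho>: "\<rho> = mono_equiv Fun (id_functor C) `` {p2}"
    by blast
  have "(s, s2) \<in> mono_equiv Fun (id_functor C)" "(t, t2) \<in> mono_equiv Fun (id_functor C)"
    using st st2 by blast+
  then have "factors_through Fun s s2" "factors_through Fun s2 s" "s2 \<in> monos_into Fun (id_functor C)"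
    "factors_through Fun t t2" "factors_through Fun t2 t" "t2 \<in> monos_into Fun (id_functor C)"
    by (auto simp: mono_equiv_def)
  then have "factors_through Fun p p2" "factors_through Fun p2 p"
    "p \<in> monos_into Fun (id_functor C)" "p2 \<in> monos_into Fun (id_functor C)"
    using coproduct_pullback_le[OF st(1) _ _ st(3) _ _ q q2 p p2]
      coproduct_pullback_le[OF _ st(1) _ _ st(3) _ q2 q p2 p]
      coproduct_pullback_iff[OF st(3) st(1) q, of p] p
      coproduct_pullback_iff[OF _ _ q2, of t2 p2] p2
    by blast+
  then show "\<rho> = mono_equiv Fun (id_functor C) `` {p}"
    unfolding \<rho> by (subst F.FC.Sub_class_eq_iff) auto
qed (use assms in blast)

text \<open>A preradical always lies below its coproduct with itself, so only the reverse comparison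
  matters; by the pullback criterion that comparison can be tested on all \<open>u\<close>.\<close>

lemma radical_iff:
  assumes \<sigma>: "\<sigma> \<in> carrier (Pr C)" "s \<in> \<sigma>" and q: "is_cokernel Fun s q"
  shows "radical C \<sigma> \<longleftrightarrow>
    (\<forall>u. is_ntrans C C u \<and> NCod u = id_functor C \<longrightarrow>
      factors_through Fun (q \<cdot>\<^bsub>Fun\<^esub> u) (whisker C s (NCod q)) \<longrightarrow> factors_through Fun u s)"
    (is "_ \<longleftrightarrow> (\<forall>u. ?nt u \<longrightarrow> ?qu u \<longrightarrow> _)")
proof -
  note s = F.FC.Sub_carrierD[OF \<sigma>[unfolded Pr_def]]
  note [simp] = Pr_monosD[OF s(1)] cokernelD[OF q]
  obtain p p' where p: "is_pullback Fun (whisker C s (NCod q)) q p p'"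
    by (rule F.ntrans_pullback_ex[of "whisker C s (NCod q)" q]) (auto simp: whisker_monic)
  have p1: "p \<in> monos_into Fun (id_functor C)"
    "\<And>u. ?nt u \<Longrightarrow> factors_through Fun u p \<longleftrightarrow> ?qu u"
    using coproduct_pullback_iff[OF s(1) s(1) q, of p] p by blast+
  note [simp] = Pr_monosD[OF p1(1)]
  \<comment> \<open>The composite of \<open>s\<close> with \<open>q\<close> is zero, and a zero
    arrow factors through anything with the right codomain.\<close>
  have "?qu s"
    using cokernelD(4)[OF q] by (intro F.FC.zero_factors_through) auto
  then have sp: "factors_through Fun s p" using p1(2)[of s] by simp
  have "radical C \<sigma> \<longleftrightarrow> mono_equiv Fun (id_functor C) `` {p} = \<sigma>"
    using \<sigma>(1) by (simp add: radical_def coproduct_eq[OF \<sigma> \<sigma> q p])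
  also have "\<dots> \<longleftrightarrow> mono_equiv Fun (id_functor C) `` {p} = mono_equiv Fun (id_functor C) `` {s}"
    by (simp only: s(2)[symmetric])
  also have "\<dots> \<longleftrightarrow> factors_through Fun p s \<and> factors_through Fun s p"
    using p1(1) s(1) by (rule F.FC.Sub_class_eq_iff)
  also have "\<dots> \<longleftrightarrow> (\<forall>u. ?nt u \<longrightarrow> ?qu u \<longrightarrow> factors_through Fun u s)"
  proof
    assume "factors_through Fun p s \<and> factors_through Fun s p"
    then show "\<forall>u. ?nt u \<longrightarrow> ?qu u \<longrightarrow> factors_through Fun u s"
      using p1(2) F.FC.factors_through_trans[of _ p s] by simp
  next
    assume "\<forall>u. ?nt u \<longrightarrow> ?qu u \<longrightarrow> factors_through Fun u s"
    then show "factors_through Fun p s \<and> factors_through Fun s p"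
      using sp p1(2)[of p] F.FC.factors_through_refl[of p] by simp
  qed
  finally show ?thesis .
qed

text \<open>Both \<open>radical_iff\<close> and \<open>intersection\<close> quantify over arbitrary
  transformations into the identity functor, so \<open>u\<close> can be tested against one
  representative at a time.\<close>

lemma radical_intersection:
  assumes rad: "\<And>i. i \<in> I \<Longrightarrow> radical C (\<sigma> i)"
    and t: "intersection Fun (id_functor C) (\<Union>(\<sigma> ` I)) t"
  shows "radical C (mono_equiv Fun (id_functor C) `` {t})"
proof -
  let ?\<tau> = "mono_equiv Fun (id_functor C) `` {t}"
  have tm: "t \<in> monos_into Fun (id_functor C)" using t by (simp add: intersection_def)
  note [simp] = Pr_monosD[OF tm]
  have \<tau>: "?\<tau> \<in> carrier (Pr C)" "t \<in> ?\<tau>"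
    using F.FC.Sub_class_in[OF tm] by (simp_all add: Pr_def)
  obtain r where r: "is_cokernel Fun t r" by (rule F.ntrans_cokernel_ex[of t]) auto
  note [simp] = cokernelD[OF r]
  have "factors_through Fun u s"
    if u [simp]: "is_ntrans C C u" "NCod u = id_functor C"
      and ru: "factors_through Fun (r \<cdot>\<^bsub>Fun\<^esub> u) (whisker C t (NCod r))"
      and i: "i \<in> I" and s: "s \<in> \<sigma> i" for u i s
  proof -
    have \<sigma>: "\<sigma> i \<in> carrier (Pr C)" using rad[OF i] by (simp add: radical_def)
    have sm: "s \<in> monos_into Fun (id_functor C)"
      using F.FC.Sub_carrierD(1) \<sigma> s unfolding Pr_def by blast
    note [simp] = Pr_monosD[OF sm]
    obtain q where q: "is_cokernel Fun s q" by (rule F.ntrans_cokernel_ex[of s]) auto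
    note [simp] = cokernelD[OF q]
    have "factors_through Fun t s"
      using t F.FC.factors_through_refl[of t] i s by (auto simp: intersection_def)
    then have "factors_through Fun (q \<cdot>\<^bsub>Fun\<^esub> u) (whisker C s (NCod q))"
      using comp_cokernel_factors_mono[OF tm sm _ tm sm _ r q u ru] by simp
    then show ?thesis
      using rad[OF i] radical_iff[OF \<sigma> s q] u by blast
  qed
  then show ?thesis
    unfolding radical_iff[OF \<tau> r] using t by (simp add: intersection_def)
qed

end

theorem proposition7p12:
  fixes A :: "('o, 'm) cat"
    and I :: "'i set"
    and \<sigma> :: "'i \<Rightarrow> ('o, 'm) preradical"
  assumes "universe TYPE('u)"
    and "abelian_category A"
    and "bicomplete TYPE('u) A"
    and "locally_small TYPE('u) A"
    and "\<And>i. i \<in> I \<Longrightarrow> radical A (\<sigma> i)"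
  shows "is_glb (Pr A) (\<Sqinter>\<^bsub>Pr A\<^esub>(\<sigma> ` I)) (\<sigma> ` I) \<and>
         radical A (\<Sqinter>\<^bsub>Pr A\<^esub>(\<sigma> ` I))"
proof -
  have "category A" using assms(2) by (simp add: abelian_category_def)
  then interpret abelian A
    using assms(2) by (simp add: abelian_def abelian_axioms_def)
  interpret F: abelian_functor_cat A A ..
  have \<sigma>: "\<sigma> ` I \<subseteq> carrier (Sub Fun (id_functor A))"
    using assms(5) by (auto simp: radical_def Pr_def)
  \<comment> \<open>Taking the union of the classes avoids choosing a representative for each
    index.\<close>
  then have M: "\<Union>(\<sigma> ` I) \<subseteq> monos_into Fun (id_functor A)"
    using F.FC.Sub_carrierD(1) by blast
  have "complete_category TYPE('u) A" using assms(3) by (simp add: bicomplete_def)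
  then obtain t where t: "intersection Fun (id_functor A) (\<Union>(\<sigma> ` I)) t"
    using assms(4) id_functor_functor M by (rule F.ntrans_intersection_ex)
  let ?\<tau> = "mono_equiv Fun (id_functor A) `` {t}"
  have glb: "is_glb (Pr A) ?\<tau> (\<sigma> ` I)"
    unfolding Pr_def using \<sigma> t by (rule F.FC.intersection_is_glb)
  \<comment> \<open>The infimum is an arbitrary choice among greatest lower bounds; the existence of
    \<open>?\<tau>\<close> makes it one, and uniqueness then identifies the two.\<close>
  then have "is_glb (Pr A) (\<Sqinter>\<^bsub>Pr A\<^esub>(\<sigma> ` I)) (\<sigma> ` I)"
    unfolding inf_def by (rule someI)
  moreover from this glb have "\<Sqinter>\<^bsub>Pr A\<^esub>(\<sigma> ` I) = ?\<tau>"
    unfolding Pr_def by (rule F.FC.Sub_glb_unique)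
  moreover have "radical A ?\<tau>"
    using assms(5) t by (rule radical_intersection)
  ultimately show ?thesis by simp
qed

end
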